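(* (1) Let $\alpha\le 1/2$, let $M,N\ge1$ be integers, and let $f\in\mathcal{J}_{\alpha,M,N}$, $f(z_1,z_2)=\sum_{k\ge0}a_kz_1^{Mk}z_2^{Nk}$, be such that $R(f)(z)=\sum_{k\ge0}a_kz^k$ is a function that admits an analytic continuation to the closed unit disk and whose zeros lie in $\mathbb{C}\setminus\mathbb{D}$. Then $f$ is cyclic in $\mathfrak{D}_\alpha$, and there exists a constant $C=C(\alpha,f,M,N)$ such that $$\operatorname{dist}^2_{\mathfrak{D}_\alpha}(1,f\cdot\mathfrak{P}_n)\le \frac{C}{\varphi_{2\alpha}(n+1)}.$$ This result is sharp in the sense that, if $R(f)$ has at least one zero on $\mathbb{T}$, then there exists a constant $c=c(\alpha,f,M,N)>0$ such that, for all large $n$, $$\frac{c}{\varphi_{2\alpha}(n+1)}\le \operatorname{dist}^2_{\mathfrak{D}_\alpha}(1,f\cdot\mathfrak{P}_n).$$ (2) The same conclusions remain valid for $f\in\mathcal{I}_\alpha$ with $\alpha\le1$, with the rate $1/\varphi_{2\alpha}$ replaced by $1/\varphi_\alpha$. That is, suppose $f(z_1,z_2)=F(z_1)$ lies in $\mathfrak{D}_\alpha$, where $F$ admits an analytic continuation to the closed unit disk and its zeros lie in $\mathbb{C}\setminus\mathbb{D}$. Then $f$ is cyclic in $\mathfrak{D}_\alpha$ and $\operatorname{dist}^2_{\mathfrak{D}_\alpha}(1,f\cdot\mathfrak{P}_n)\le C/\varphi_\alpha(n+1)$ for some constant $C=C(\alpha,f)$. If in addition $F$ has at least one zero on $\mathbb{T}$,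 then $\operatorname{dist}^2_{\mathfrak{D}_\alpha}(1,f\cdot\mathfrak{P}_n)\ge c/\varphi_\alpha(n+1)$ for all large $n$, for some constant $c=c(\alpha,f)>0$.
   Context: $\mathbb{D}$ is the open unit disk in $\mathbb{C}$ and $\mathbb{T}$ the unit circle. For $\alpha\in\mathbb{R}$, $\mathfrak{D}_\alpha$ is the Hilbert space of holomorphic functions $f(z_1,z_2)=\sum_{k,l\ge0}a_{k,l}z_1^kz_2^l$ on the bidisk $\mathbb{D}^2$ with $\|f\|_\alpha^2=\sum_{k,l\ge0}(k+1)^\alpha(l+1)^\alpha|a_{k,l}|^2<\infty$. A function $f\in\mathfrak{D}_\alpha$ is cyclic if the closed linear span of $\{z_1^kz_2^lf: k,l\ge0\}$ is all of $\mathfrak{D}_\alpha$; equivalently, there are polynomials $p_n$ in two variables with $\|p_nf-1\|_\alpha\to0$. For integers $M,N\ge1$, $\mathcal{J}_{\alpha,M,N}$ is the closed subspace of $\mathfrak{D}_\alpha$ of functions of the form $f=\sum_{k\ge0}a_kz_1^{Mk}z_2^{Nk}$. For such $f$, $R(f)(z)=f(z^{1/M},1)$ means the one-variable power series $\sum_{k\ge0}a_kz^k$. $\mathcal{I}_\alpha$ is the subspace of functions in $\mathfrak{D}_\alpha$ that do not depend on $z_2$. For $n\ge1$, $\mathfrak{P}_n$ is the space of polynomials $\sum_{k=0}^n\sum_{l=0}^n c_{k,l}z_1^kz_2^l$, and $\operatorname{dist}_{\mathfrak{D}_\alpha}(1,f\cdot\mathfrak{P}_n)=\inf\{\|pf-1\|_\alpha: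 p\in\mathfrak{P}_n\}$; bounds are for integers $n\ge1$. For $\beta<1$, $\varphi_\beta(s)=s^{1-\beta}$, and $\varphi_1(s)=\log^+(s)=\max\{\log s,0\}$, for $s\in[0,\infty)$. A function "admits an analytic continuation to the closed unit disk" if it extends analytically to an open neighbourhood of $\overline{\mathbb{D}}$. *)

theory Defs
  imports "HOL-Complex_Analysis.Complex_Analysis"
begin

definition bidisk :: "(complex \<times> complex) set" where
  "bidisk = ball 0 1 \<times> ball 0 1"

text \<open>
  A holomorphic function on the bidisk is represented by a total function on
  \<open>\<complex> \<times> \<complex>\<close> which is the sum of a double power series on the bidisk; its values
  off the bidisk are arbitrary, and no notion below depends on them.
  Since \<open>has_sum\<close> is unordered summation, the series converges absolutely at
  every point of the bidisk.
\<close>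

definition has_bidisk_expansion ::
    "(complex \<times> complex \<Rightarrow> complex) \<Rightarrow> (nat \<Rightarrow> nat \<Rightarrow> complex) \<Rightarrow> bool" where
  "has_bidisk_expansion f a \<longleftrightarrow>
     (\<forall>(z1, z2)\<in>bidisk. ((\<lambda>(k, l). a k l * z1 ^ k * z2 ^ l) has_sum f (z1, z2)) UNIV)"

definition bidisk_coeff :: "(complex \<times> complex \<Rightarrow> complex) \<Rightarrow> nat \<Rightarrow> nat \<Rightarrow> complex" where
  "bidisk_coeff f = (THE a. has_bidisk_expansion f a)"

lemma powser_zero_imp_coeff_zero:
  fixes a :: "nat \<Rightarrow> complex"
  assumes "\<And>z. norm z < 1 \<Longrightarrow> (\<lambda>n. a n * z ^ n) sums 0"
  shows "a n = 0"
proof (cases "n = 0")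
  case True
  have "(\<lambda>n. a n * 0 ^ n) sums a 0"
    by (rule powser_sums_zero)
  moreover have "(\<lambda>n. a n * 0 ^ n) sums 0"
    using assms[of 0] by simp
  ultimately show ?thesis
    using True sums_unique2 by blast
next
  case False
  show ?thesis
  proof (rule ccontr)
    assume "a n \<noteq> 0"
    then obtain s where "0 < s" "\<And>z. z \<in> cball (0::complex) s - {0} \<Longrightarrow> (\<lambda>_. 0 :: complex) z \<noteq> 0"
      using powser_0_nonzero[of 1 0 a "\<lambda>_. 0" n] assms False by auto
    from this(1) this(2)[of "of_real s"] show False
      by auto
  qed
qed

lemma has_bidisk_expansion_unique:
  assumes "has_bidisk_expansion f a" "has_bidisk_expansion f b"
  shows "a = b"
proof (intro ext)
  fix k l
  define c where "c k l = a k l - b k l" for k l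
  have c: "((\<lambda>(k, l). c k l * z1 ^ k * z2 ^ l) has_sum 0) UNIV"
    if "norm z1 < 1" "norm z2 < 1" for z1 z2
  proof -
    have a: "((\<lambda>(k, l). a k l * z1 ^ k * z2 ^ l) has_sum f (z1, z2)) UNIV"
      and b: "((\<lambda>(k, l). b k l * z1 ^ k * z2 ^ l) has_sum f (z1, z2)) UNIV"
      using assms that by (auto simp: has_bidisk_expansion_def bidisk_def)
    from has_sum_add[OF a has_sum_cmult_right[OF b, of "-1"]] show ?thesis
      by (simp add: c_def case_prod_unfold algebra_simps)
  qed
  have row: "(\<lambda>l. c k l * z2 ^ l) sums 0" if z2: "norm z2 < 1" for z2 k
  proof -
    define g where "g k = infsum (\<lambda>l. c k l * z2 ^ l) UNIV" for k
    have g: "((\<lambda>l. c k l * z2 ^ l) has_sum g k) UNIV" for k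
    proof -
      have "(\<lambda>(k, l). c k l * (1/2) ^ k * z2 ^ l) summable_on Sigma UNIV (\<lambda>_. UNIV)"
        using c[of "1/2" z2] z2 by (auto simp: summable_on_def)
      from summable_on_SigmaD1[OF this, of k]
      have "(\<lambda>l. (1/2) ^ k * (c k l * z2 ^ l)) summable_on UNIV"
        by (simp add: algebra_simps)
      from summable_on_cmult_right[OF this, of "2 ^ k"]
      show ?thesis unfolding g_def
        by (intro has_sum_infsum) (simp add: power_divide)
    qed
    have "g k = 0" for k
    proof (rule powser_zero_imp_coeff_zero)
      fix z1 :: complex assume z1: "norm z1 < 1"
      have "((\<lambda>k. g k * z1 ^ k) has_sum 0) UNIV"
      proof (rule has_sum_SigmaD)
        show "((\<lambda>(k, l). c k l * z1 ^ k * z2 ^ l) has_sum 0) (Sigma UNIV (\<lambda>_. UNIV))"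
          using c[OF z1 z2] by simp
        show "((\<lambda>l. case (k, l) of (k, l) \<Rightarrow> c k l * z1 ^ k * z2 ^ l) has_sum g k * z1 ^ k) UNIV" for k
          using has_sum_cmult_left[OF g[of k], of "z1 ^ k"] by (simp add: algebra_simps)
      qed
      then show "(\<lambda>k. g k * z1 ^ k) sums 0"
        by (rule has_sum_imp_sums)
    qed
    with g[of k] show ?thesis
      using has_sum_imp_sums by fastforce
  qed
  have "c k l = 0"
    using row by (rule powser_zero_imp_coeff_zero)
  then show "a k l = b k l"
    by (simp add: c_def)
qed

lemma bidisk_coeff_eq: "has_bidisk_expansion f a \<Longrightarrow> bidisk_coeff f = a"
  unfolding bidisk_coeff_def using has_bidisk_expansion_unique by blast

definition dirichlet_space :: "real \<Rightarrow> (complex \<times> complex \<Rightarrow> complex) set" where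
  "dirichlet_space \<alpha> = {f. \<exists>a. has_bidisk_expansion f a \<and>
     (\<lambda>(k, l). (real k + 1) powr \<alpha> * (real l + 1) powr \<alpha> * (cmod (a k l))\<^sup>2) summable_on UNIV}"

text \<open>
  The norm is meaningful only on \<open>dirichlet_space \<alpha>\<close>. It is only ever applied to functions
  \<open>p f - g\<close> with \<open>p\<close> a polynomial and \<open>f\<close>, \<open>g\<close> in the space; these lie in the space,
  as polynomials are multipliers of it.
\<close>

definition dirichlet_norm :: "real \<Rightarrow> (complex \<times> complex \<Rightarrow> complex) \<Rightarrow> real" where
  "dirichlet_norm \<alpha> f = sqrt (\<Sum>\<^sub>\<infinity>(k, l).
     (real k + 1) powr \<alpha> * (real l + 1) powr \<alpha> * (cmod (bidisk_coeff f k l))\<^sup>2)"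

definition poly_space :: "nat \<Rightarrow> (complex \<times> complex \<Rightarrow> complex) set" where
  "poly_space n = {p. \<exists>c :: nat \<Rightarrow> nat \<Rightarrow> complex.
     p = (\<lambda>(z1, z2). \<Sum>k\<le>n. \<Sum>l\<le>n. c k l * z1 ^ k * z2 ^ l)}"

definition dist_one :: "real \<Rightarrow> (complex \<times> complex \<Rightarrow> complex) \<Rightarrow> nat \<Rightarrow> real" where
  "dist_one \<alpha> f n = (INF p\<in>poly_space n. dirichlet_norm \<alpha> (\<lambda>z. p z * f z - 1))"

text \<open>The linear span of the functions \<open>z\<^sub>1\<^sup>k z\<^sub>2\<^sup>l f\<close>, and its closure in \<open>dirichlet_space \<alpha>\<close>.\<close>

definition shift_span :: "(complex \<times> complex \<Rightarrow> complex) \<Rightarrow> (complex \<times> complex \<Rightarrow> complex) set" where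
  "shift_span f = {h. \<exists>n (c :: nat \<Rightarrow> nat \<Rightarrow> complex).
     h = (\<lambda>(z1, z2). \<Sum>k\<le>n. \<Sum>l\<le>n. c k l * (z1 ^ k * z2 ^ l * f (z1, z2)))}"

definition closed_shift_span ::
    "real \<Rightarrow> (complex \<times> complex \<Rightarrow> complex) \<Rightarrow> (complex \<times> complex \<Rightarrow> complex) set" where
  "closed_shift_span \<alpha> f = {g \<in> dirichlet_space \<alpha>.
     \<forall>\<epsilon>>0. \<exists>h\<in>shift_span f. dirichlet_norm \<alpha> (\<lambda>z. h z - g z) < \<epsilon>}"

definition cyclic :: "real \<Rightarrow> (complex \<times> complex \<Rightarrow> complex) \<Rightarrow> bool" where
  "cyclic \<alpha> f \<longleftrightarrow> f \<in> dirichlet_space \<alpha> \<and> closed_shift_span \<alpha> f = dirichlet_space \<alpha>"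

definition J_space :: "real \<Rightarrow> nat \<Rightarrow> nat \<Rightarrow> (complex \<times> complex \<Rightarrow> complex) set" where
  "J_space \<alpha> M N = {f \<in> dirichlet_space \<alpha>. \<exists>a :: nat \<Rightarrow> complex.
     \<forall>(z1, z2)\<in>bidisk. (\<lambda>k. a k * z1 ^ (M * k) * z2 ^ (N * k)) sums f (z1, z2)}"

text \<open>
  For \<open>f\<close> in \<open>J_space \<alpha> M N\<close> with \<open>M, N \<ge> 1\<close>, the coefficient \<open>a k\<close> is the double power series
  coefficient of \<open>f\<close> with index \<open>(M k, N k)\<close>. \<open>R_op\<close> is meant on the unit disk, where its
  series converges.
\<close>

definition R_op :: "nat \<Rightarrow> nat \<Rightarrow> (complex \<times> complex \<Rightarrow> complex) \<Rightarrow> complex \<Rightarrow> complex" where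
  "R_op M N f z = (\<Sum>k. bidisk_coeff f (M * k) (N * k) * z ^ k)"

definition I_space :: "real \<Rightarrow> (complex \<times> complex \<Rightarrow> complex) set" where
  "I_space \<alpha> = {f \<in> dirichlet_space \<alpha>.
     \<forall>z1\<in>ball 0 1. \<forall>z2\<in>ball 0 1. \<forall>w2\<in>ball 0 1. f (z1, z2) = f (z1, w2)}"

text \<open>
  \<open>analytic_on\<close> a closed set means holomorphic on some open neighbourhood of it
  (\<open>analytic_on_holomorphic\<close>). On the closed disk such a continuation is unique, by continuity.
\<close>

definition continues_to_closed_disk :: "(complex \<Rightarrow> complex) \<Rightarrow> (complex \<Rightarrow> complex) \<Rightarrow> bool" where
  "continues_to_closed_disk g F \<longleftrightarrow> F analytic_on cball 0 1 \<and> (\<forall>z\<in>ball 0 1. F z = g z)"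

text \<open>Only used for \<open>\<beta> \<le> 1\<close>.\<close>

definition phi :: "real \<Rightarrow> real \<Rightarrow> real" where
  "phi \<beta> s = (if \<beta> = 1 then max (ln s) 0 else s powr (1 - \<beta>))"

end

(*
  Functions of z1^M z2^N (and, with M = 1 and N = 0, functions of z1 alone) reduce the problem to
  one variable: discarding the coefficients whose index is not of the form (M k, N k) does not
  increase the norm, and on the remaining ones the weight is comparable to (k+1)^beta with beta = 2 alpha (or alpha).

  Upper bound. For a linear factor 1 - c z with |c| = 1 the polynomial multiple nearest to 1 is
  1 - E with E proportional to the sum of (k+1)^(-beta) (c z)^k over k <= n; its weighted l2 norm
  is (sum of (k+1)^(-beta))^(-1/2), which is the claimed rate, and its l1 norm is 1. If u and v
  are invertible up to errors E1 and E2, then uv is invertible up to E1 + E2 - E1 E2, and since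
  beta <= 1 the weighted l2 norm of a product is at most a constant times
  |E1|_1 |E2|_w + |E1|_w |E2|_1. So the rate passes to products, hence from linear factors and
  zero-free functions (for which truncations of 1/g converge geometrically) to every F.

  Lower bound. If F has a zero on the unit circle then 1 - P F takes the value 1 there, and
  Cauchy-Schwarz bounds this value by the norm times (sum of (k+1)^(-beta))^(1/2).
*)

theory Submission
  imports Defs "HOL-Real_Asymp.Real_Asymp"
begin

text \<open>For \<beta> \<le> 1 the sum of (k+1)^(-\<beta>) diverges. This is why the distance to 1
  tends to 0 although F may vanish on the circle, and it goes along with weighted l2 not being
  closed under products. Hence the l1 norm is carried along: it need only stay bounded while the
  weighted norm tends to 0, and the mixed product estimate asks for no more. The E for 1 - c z
  solves an extremal problem. A multiple 1 - E of 1 - c z satisfies E(1/c) = 1, and the least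
  weighted norm under this constraint is the equality case of Cauchy-Schwarz; the lower bound rests
  on the same inequality, so the rates agree. Products of approximants and the substitution of z1^M
  z2^N multiply degrees by constants. The partial sums of (k+1)^(-\<beta>) change only by a constant
  factor under such dilations, so the order of magnitude of the degree is all that matters. For the
  lower bound the divergence is an obstacle: Cauchy-Schwarz over all coefficients of 1 - P F is
  void, so the series has to be cut at an index comparable to n.\<close>

section \<open>Comparison of real powers\<close>

text \<open>Monotonicity of \<open>powr\<close> changes direction with the sign of the exponent. The
  factor \<open>a powr \<bar>t\<bar>\<close> serves both signs and both directions, so later
  estimates need no case distinction on \<alpha> or \<beta>.\<close>

lemma powr_comparable:
  fixes a x y t :: real
  assumes "0 < y" "y \<le> x" "x \<le> a * y" "1 \<le> a"
  shows "x powr t \<le> a powr \<bar>t\<bar> * y powr t" "y powr t \<le> a powr \<bar>t\<bar> * x powr t"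
proof -
  have a1: "1 \<le> a powr \<bar>t\<bar>"
    using assms by (simp add: ge_one_powr_ge_zero)
  show "x powr t \<le> a powr \<bar>t\<bar> * y powr t"
  proof (cases "t \<ge> 0")
    case True
    then have "x powr t \<le> (a * y) powr t"
      using assms by (intro powr_mono2) auto
    then show ?thesis using True assms by (simp add: powr_mult)
  next
    case False
    then have "x powr t \<le> y powr t"
      using assms by (intro powr_mono2') auto
    also have "\<dots> \<le> a powr \<bar>t\<bar> * y powr t"
      using a1 by (simp add: mult_le_cancel_right1)
    finally show ?thesis .
  qed
  show "y powr t \<le> a powr \<bar>t\<bar> * x powr t"
  proof (cases "t \<ge> 0")
    case True
    then have "y powr t \<le> x powr t"
      using assms by (intro powr_mono2) auto
    also have "\<dots> \<le> a powr \<bar>t\<bar> * x powr t"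
      using a1 by (simp add: mult_le_cancel_right1)
    finally show ?thesis .
  next
    case False
    then have "(a * y) powr t \<le> x powr t"
      using assms by (intro powr_mono2') auto
    then have "a powr \<bar>t\<bar> * (a powr t * y powr t) \<le> a powr \<bar>t\<bar> * x powr t"
      using assms by (simp add: powr_mult)
    moreover have "a powr \<bar>t\<bar> * a powr t = 1"
      using False assms by (simp flip: powr_add)
    ultimately show ?thesis by (simp flip: mult.assoc)
  qed
qed

lemma powr_add_le:
  fixes i j :: nat
  shows "(real (i + j) + 1) powr t \<le> (real j + 1) powr \<bar>t\<bar> * (real i + 1) powr t"
  by (rule powr_comparable) (auto simp: algebra_simps)

section \<open>The partial sums governing the rate\<close>

text \<open>The square of the norm of evaluation at a point of the unit circle, on polynomials of
  degree at most n normed by the weights (k+1)^\<beta>.\<close>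

definition psum :: "real \<Rightarrow> nat \<Rightarrow> real" where
  "psum \<beta> n = (\<Sum>k\<le>n. (real k + 1) powr (-\<beta>))"

lemma psum_mono: "m \<le> n \<Longrightarrow> psum \<beta> m \<le> psum \<beta> n"
  unfolding psum_def by (intro sum_mono2) auto

lemma psum_ge_1: "1 \<le> psum \<beta> n"
  using psum_mono[of 0 n \<beta>] by (simp add: psum_def)

lemma psum_pos [simp]: "0 < psum \<beta> n"
  using psum_ge_1[of \<beta> n] by linarith

text \<open>A crude polynomial bound suffices where it is played off against geometrically decaying
  coefficients.\<close>

lemma psum_le_powr: "psum \<beta> n \<le> (real n + 1) powr (1 + \<bar>\<beta>\<bar>)"
proof -
  have "psum \<beta> n \<le> (\<Sum>k\<le>n. (real n + 1) powr \<bar>\<beta>\<bar>)"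
    unfolding psum_def
  proof (rule sum_mono)
    fix k assume "k \<in> {..n}"
    have "(real k + 1) powr (-\<beta>) \<le> (real k + 1) powr \<bar>\<beta>\<bar>"
      by (intro powr_mono) auto
    also have "\<dots> \<le> (real n + 1) powr \<bar>\<beta>\<bar>"
      using \<open>k \<in> {..n}\<close> by (intro powr_mono2) auto
    finally show "(real k + 1) powr (-\<beta>) \<le> (real n + 1) powr \<bar>\<beta>\<bar>" .
  qed
  then show ?thesis by (simp add: powr_add add.commute)
qed

text \<open>The dilation estimate: passing from degree n to n div d costs a constant factor. It pays
  for the degree growth in the upper bound and for the cut at 2n in the lower bound.\<close>

lemma psum_div_le:
  assumes "d \<ge> 1"
  shows "psum \<beta> n \<le> real d powr (1 + \<bar>\<beta>\<bar>) * psum \<beta> (n div d)"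
proof -
  define m where "m = n div d"
  have "n < (m + 1) * d"
    unfolding m_def using assms dividend_less_div_times[of d n] by simp
  then have "psum \<beta> n \<le> (\<Sum>k<(m + 1) * d. (real k + 1) powr (-\<beta>))"
    unfolding psum_def by (intro sum_mono2) auto
  \<comment> \<open>Blocks of d consecutive indices: in block j one has j + 1 \<le> k + 1 \<le> d (j
    + 1), so every term is comparable to the j-th term of the short sum, and the d terms of a block
    give one more factor d.\<close>
  also have "\<dots> = (\<Sum>j<m + 1. \<Sum>k=j*d..<j*d+d. (real k + 1) powr (-\<beta>))"
    by (rule sum.nat_group[symmetric])
  also have "\<dots> \<le> (\<Sum>j<m + 1. \<Sum>k=j*d..<j*d+d. real d powr \<bar>\<beta>\<bar> * (real j + 1) powr (-\<beta>))"
  proof (intro sum_mono)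
    fix j k assume "k \<in> {j*d..<j*d+d}"
    then have k: "j * d \<le> k" "k + 1 \<le> (j + 1) * d"
      by auto
    have "j \<le> j * d"
      using assms by simp
    then have "j \<le> k" using k by linarith
    moreover have "real k + 1 \<le> real d * (real j + 1)"
      using k(2) by (metis of_nat_le_iff of_nat_mult of_nat_add of_nat_1 mult.commute)
    ultimately show "(real k + 1) powr (-\<beta>) \<le> real d powr \<bar>\<beta>\<bar> * (real j + 1) powr (-\<beta>)"
      using powr_comparable(1)[of "real j + 1" "real k + 1" "real d" "-\<beta>"] assms by simp
  qed
  also have "\<dots> = real d powr (1 + \<bar>\<beta>\<bar>) * psum \<beta> m"
    using assms by (simp add: psum_def sum_distrib_left powr_add mult.assoc lessThan_Suc_atMost)
  finally show ?thesis by (simp add: m_def)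
qed

text \<open>A discrete integral test. By the mean value theorem the increment is (1 - \<beta>)
  \<xi>^(-\<beta>) with k < \<xi> < k + 1, and k \<ge> 1 gives k + 1 \<le> 2 \<xi>, so \<xi> may be
  replaced by k + 1 at the cost of \<open>2 powr \<bar>\<beta>\<bar>\<close>.\<close>

lemma powr_increment_bounds:
  assumes "\<beta> < 1" "k \<ge> 1"
  shows "(1 - \<beta>) * (real k + 1) powr (-\<beta>) \<le>
           2 powr \<bar>\<beta>\<bar> * ((real k + 1) powr (1 - \<beta>) - real k powr (1 - \<beta>))"
    and "(real k + 1) powr (1 - \<beta>) - real k powr (1 - \<beta>) \<le>
           (1 - \<beta>) * (2 powr \<bar>\<beta>\<bar> * (real k + 1) powr (-\<beta>))"
proof -
  have "\<exists>\<xi>. real k < \<xi> \<and> \<xi> < real k + 1 \<and>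
      (real k + 1) powr (1 - \<beta>) - real k powr (1 - \<beta>) =
        (real k + 1 - real k) * ((1 - \<beta>) * \<xi> powr (1 - \<beta> - 1))"
    using assms by (intro MVT2) (auto intro!: derivative_eq_intros)
  then obtain \<xi> where \<xi>: "real k < \<xi>" "\<xi> < real k + 1"
      "(real k + 1) powr (1 - \<beta>) - real k powr (1 - \<beta>) = (1 - \<beta>) * \<xi> powr (-\<beta>)"
    by auto
  have "real k + 1 \<le> 2 * \<xi>"
    using \<xi> assms by simp
  then have "(real k + 1) powr (-\<beta>) \<le> 2 powr \<bar>\<beta>\<bar> * \<xi> powr (-\<beta>)"
    "\<xi> powr (-\<beta>) \<le> 2 powr \<bar>\<beta>\<bar> * (real k + 1) powr (-\<beta>)"
    using powr_comparable[of \<xi> "real k + 1" 2 "-\<beta>"] \<xi> assms by auto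
  then show "(1 - \<beta>) * (real k + 1) powr (-\<beta>) \<le>
           2 powr \<bar>\<beta>\<bar> * ((real k + 1) powr (1 - \<beta>) - real k powr (1 - \<beta>))"
    and "(real k + 1) powr (1 - \<beta>) - real k powr (1 - \<beta>) \<le>
           (1 - \<beta>) * (2 powr \<bar>\<beta>\<bar> * (real k + 1) powr (-\<beta>))"
    using \<xi>(3) assms by (auto simp: mult.left_commute)
qed

lemma psum_1: "psum 1 n = harm (Suc n)"
proof (induction n)
  case (Suc n)
  then show ?case
    by (subst harm_Suc) (simp add: psum_def powr_minus add.commute)
qed (simp add: psum_def harm_def)

text \<open>At n = 0 and \<beta> = 1 the right-hand side is log 1 = 0 while the sum is 1, whence the
  restriction n \<ge> 1.\<close>

lemma psum_le_phi:
  assumes "\<beta> \<le> 1"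
  obtains C where "C > 0" "\<And>n. n \<ge> 1 \<Longrightarrow> psum \<beta> n \<le> C * phi \<beta> (real n + 1)"
proof (cases "\<beta> = 1")
  case True
  show ?thesis
  \<comment> \<open>The harmonic sum is at most 1 + ln(n+1), and for n \<ge> 1 the summand 1 is at
    most ln(n+1) / ln 2.\<close>
  proof (rule that[of "1 / ln 2 + 1"])
    fix n :: nat assume "n \<ge> 1"
    have "harm (Suc n) - ln (real (Suc n)) \<le> harm (Suc 0) - ln (real (Suc 0))"
      using decseqD[OF decseq_harm_diff_ln, of 0 n] by simp
    then have "psum 1 n \<le> 1 + ln (real n + 1)"
      by (simp add: psum_1 harm_def add.commute)
    moreover have "ln 2 \<le> ln (real n + 1)"
      using \<open>n \<ge> 1\<close> by simp
    then have "1 \<le> 1 / ln 2 * ln (real n + 1)"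
      by (simp add: field_simps)
    ultimately have "psum 1 n \<le> (1 / ln 2 + 1) * ln (real n + 1)"
      unfolding ring_distribs by linarith
    then show "psum \<beta> n \<le> (1 / ln 2 + 1) * phi \<beta> (real n + 1)"
      using True by (simp add: phi_def)
  qed (simp add: add_pos_pos)
next
  case False
  then have \<beta>: "\<beta> < 1" using assms by simp
  \<comment> \<open>The summand 1 covers the base case n = 0, the other one the induction
    step.\<close>
  define C where "C = 1 + 2 powr \<bar>\<beta>\<bar> / (1 - \<beta>)"
  have C: "C \<ge> 1" "2 powr \<bar>\<beta>\<bar> / (1 - \<beta>) \<le> C"
    using \<beta> by (auto simp: C_def)
  have "psum \<beta> n \<le> C * (real n + 1) powr (1 - \<beta>)" for n
  proof (induction n)
    case 0
    then show ?case using C by (simp add: psum_def)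
  next
    case (Suc n)
    have "(real n + 2) powr (1 - \<beta>) - (real n + 1) powr (1 - \<beta>) \<ge> 0"
      using \<beta> by (simp add: powr_mono2)
    then have "(2 powr \<bar>\<beta>\<bar> / (1 - \<beta>)) * ((real n + 2) powr (1 - \<beta>) - (real n + 1) powr (1 - \<beta>))
        \<le> C * ((real n + 2) powr (1 - \<beta>) - (real n + 1) powr (1 - \<beta>))"
      using C by (intro mult_right_mono) auto
    moreover have "(real n + 2) powr (-\<beta>) \<le>
        (2 powr \<bar>\<beta>\<bar> / (1 - \<beta>)) * ((real n + 2) powr (1 - \<beta>) - (real n + 1) powr (1 - \<beta>))"
      using powr_increment_bounds(1)[OF \<beta>, of "Suc n"] \<beta> by (simp add: field_simps)
    ultimately have "(real n + 2) powr (-\<beta>) \<le>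
        C * ((real n + 2) powr (1 - \<beta>) - (real n + 1) powr (1 - \<beta>))"
      by linarith
    then show ?case
      using Suc by (simp add: psum_def ring_distribs add_ac)
  qed
  then show ?thesis
    using that[of C] C False by (simp add: phi_def)
qed

lemma phi_le_psum:
  assumes "\<beta> \<le> 1"
  obtains C where "C > 0" "\<And>n. phi \<beta> (real n + 1) \<le> C * psum \<beta> n"
proof (cases "\<beta> = 1")
  case True
  show ?thesis
  proof (rule that[of 1])
    fix n
    have "ln (real n + 1) \<le> harm (Suc n)"
      using ln_le_harm[of n] by (simp add: harm_Suc add_increasing2)
    then show "phi \<beta> (real n + 1) \<le> 1 * psum \<beta> n"
      using True by (simp add: phi_def psum_1)
  qed simp
next
  case False
  then have \<beta>: "\<beta> < 1" using assms by simp
  define C where "C = 1 + 2 powr \<bar>\<beta>\<bar> * (1 - \<beta>)"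
  have C: "C \<ge> 1" "2 powr \<bar>\<beta>\<bar> * (1 - \<beta>) \<le> C"
    using \<beta> by (auto simp: C_def)
  have "(real n + 1) powr (1 - \<beta>) \<le> C * psum \<beta> n" for n
  proof (induction n)
    case 0
    then show ?case using C by (simp add: psum_def)
  next
    case (Suc n)
    have "(real n + 2) powr (1 - \<beta>) - (real n + 1) powr (1 - \<beta>) \<le>
        (2 powr \<bar>\<beta>\<bar> * (1 - \<beta>)) * (real n + 2) powr (-\<beta>)"
      using powr_increment_bounds(2)[OF \<beta>, of "Suc n"] by (simp add: algebra_simps)
    also have "\<dots> \<le> C * (real n + 2) powr (-\<beta>)"
      using C by (intro mult_right_mono) auto
    finally show ?case
      using Suc by (simp add: psum_def ring_distribs add_ac)
  qed
  then show ?thesis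
    using that[of C] C False by (simp add: phi_def)
qed

lemma phi_pos: "n \<ge> 1 \<Longrightarrow> phi \<beta> (real n + 1) > 0"
  by (auto simp: phi_def)

lemma filterlim_phi:
  assumes "\<beta> \<le> 1"
  shows "filterlim (\<lambda>n. phi \<beta> (real n + 1)) at_top sequentially"
proof (cases "\<beta> = 1")
  case True
  have "filterlim (\<lambda>n. ln (real n + 1)) at_top sequentially"
    by real_asymp
  then show ?thesis
    using True by (auto simp: phi_def elim!: filterlim_at_top_mono)
next
  case False
  then have "1 - \<beta> > 0" using assms by simp
  then have "filterlim (\<lambda>n. (real n + 1) powr (1 - \<beta>)) at_top sequentially"
    by real_asymp
  then show ?thesis
    using False by (simp add: phi_def)
qed

section \<open>The \<open>\<ell>\<^sup>1\<close> norm and the weighted \<open>\<ell>\<^sup>2\<close> norm of power series\<close>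

text \<open>Norm bounds are uniform bounds on partial sums, so the inequalities below are finite
  ones and carry no summability conditions.\<close>

definition l1_bounded :: "complex fps \<Rightarrow> real \<Rightarrow> bool" where
  "l1_bounded F C \<longleftrightarrow> (\<forall>n. (\<Sum>k\<le>n. cmod (fps_nth F k)) \<le> C)"

text \<open>The weight multiplies the unsquared coefficient: \<gamma> = \<beta>/2 corresponds to the
  weight (k+1)^\<beta> in the squared norm.\<close>

definition wl2_bounded :: "real \<Rightarrow> complex fps \<Rightarrow> real \<Rightarrow> bool" where
  "wl2_bounded \<gamma> F C \<longleftrightarrow> (\<forall>n. L2_set (\<lambda>k. (real k + 1) powr \<gamma> * cmod (fps_nth F k)) {..n} \<le> C)"

lemma l1_boundedD: "l1_bounded F C \<Longrightarrow> (\<Sum>k\<le>n. cmod (fps_nth F k)) \<le> C"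
  by (simp add: l1_bounded_def)

lemma wl2_boundedD:
  "wl2_bounded \<gamma> F C \<Longrightarrow> L2_set (\<lambda>k. (real k + 1) powr \<gamma> * cmod (fps_nth F k)) {..n} \<le> C"
  by (simp add: wl2_bounded_def)

lemma l1_bounded_nonneg: "l1_bounded F C \<Longrightarrow> 0 \<le> C"
  using l1_boundedD[of F C 0] by (simp add: order_trans[OF norm_ge_zero])

lemma wl2_bounded_nonneg: "wl2_bounded \<gamma> F C \<Longrightarrow> 0 \<le> C"
  using wl2_boundedD[of \<gamma> F C 0] L2_set_nonneg order_trans by blast

lemma l1_bounded_add: "l1_bounded F C \<Longrightarrow> l1_bounded G D \<Longrightarrow> l1_bounded (F + G) (C + D)"
  unfolding l1_bounded_def
proof
  fix n assume "\<forall>n. (\<Sum>k\<le>n. cmod (fps_nth F k)) \<le> C" "\<forall>n. (\<Sum>k\<le>n. cmod (fps_nth G k)) \<le> D"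
  then have "(\<Sum>k\<le>n. cmod (fps_nth F k)) + (\<Sum>k\<le>n. cmod (fps_nth G k)) \<le> C + D"
    by (intro add_mono) auto
  moreover have "(\<Sum>k\<le>n. cmod (fps_nth (F + G) k)) \<le> (\<Sum>k\<le>n. cmod (fps_nth F k)) + (\<Sum>k\<le>n. cmod (fps_nth G k))"
    unfolding sum.distrib[symmetric] by (intro sum_mono) (simp add: norm_triangle_ineq)
  ultimately show "(\<Sum>k\<le>n. cmod (fps_nth (F + G) k)) \<le> C + D" by linarith
qed

lemma l1_bounded_uminus [simp]: "l1_bounded (- F) C \<longleftrightarrow> l1_bounded F C"
  by (simp add: l1_bounded_def)

lemma wl2_bounded_uminus [simp]: "wl2_bounded \<gamma> (- F) C \<longleftrightarrow> wl2_bounded \<gamma> F C"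
  by (simp add: wl2_bounded_def)

lemma wl2_bounded_add:
  assumes "wl2_bounded \<gamma> F C" "wl2_bounded \<gamma> G D"
  shows "wl2_bounded \<gamma> (F + G) (C + D)"
  unfolding wl2_bounded_def
proof
  fix n
  have "L2_set (\<lambda>k. (real k + 1) powr \<gamma> * cmod (fps_nth (F + G) k)) {..n} \<le>
      L2_set (\<lambda>k. (real k + 1) powr \<gamma> * cmod (fps_nth F k) + (real k + 1) powr \<gamma> * cmod (fps_nth G k)) {..n}"
    unfolding distrib_left[symmetric] fps_add_nth
    by (intro L2_set_mono mult_left_mono norm_triangle_ineq) auto
  also have "\<dots> \<le> C + D"
    using L2_set_triangle_ineq add_mono[OF wl2_boundedD[OF assms(1)] wl2_boundedD[OF assms(2)]]
    by (rule order_trans)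
  finally show "L2_set (\<lambda>k. (real k + 1) powr \<gamma> * cmod (fps_nth (F + G) k)) {..n} \<le> C + D" .
qed

lemma L2_set_sum_le: "finite I \<Longrightarrow> L2_set (\<lambda>k. \<Sum>i\<in>I. f i k) A \<le> (\<Sum>i\<in>I. L2_set (f i) A)"
proof (induction I rule: finite_induct)
  case (insert i I)
  then show ?case
    using L2_set_triangle_ineq[of "f i" "\<lambda>k. \<Sum>i\<in>I. f i k" A] by simp
qed (simp add: L2_set_0')

lemma sum_shift_le:
  fixes y :: "nat \<Rightarrow> real"
  assumes "\<And>k. 0 \<le> y k"
  shows "(\<Sum>k\<le>n. if i \<le> k then y (k - i) else 0) \<le> (\<Sum>k\<le>n. y k)"
proof -
  have "(\<Sum>k\<le>n. if i \<le> k then y (k - i) else 0) = (\<Sum>k\<in>{i..n}. y (k - i))"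
    by (intro sum.mono_neutral_cong_right) auto
  also have "\<dots> = sum y ((\<lambda>k. k - i) ` {i..n})"
    by (subst sum.reindex) (auto simp: inj_on_def)
  also have "\<dots> \<le> (\<Sum>k\<le>n. y k)"
    using assms by (intro sum_mono2) auto
  finally show ?thesis .
qed

lemma L2_set_shift_le:
  fixes y :: "nat \<Rightarrow> real"
  shows "L2_set (\<lambda>k. if i \<le> k then y (k - i) else 0) {..n} \<le> L2_set y {..n}"
proof -
  have "(\<Sum>k\<le>n. (if i \<le> k then y (k - i) else 0)\<^sup>2) = (\<Sum>k\<le>n. if i \<le> k then (y (k - i))\<^sup>2 else 0)"
    by (intro sum.cong) auto
  then show ?thesis
    unfolding L2_set_def using sum_shift_le[of "\<lambda>k. (y k)\<^sup>2" i n] by simp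
qed

text \<open>Writes a convolution as a superposition of shifts with a range of summation common to
  all k, so that sums can be swapped and the triangle inequality applied.\<close>

lemma convolution_extend:
  fixes x y :: "nat \<Rightarrow> real"
  assumes "k \<le> n"
  shows "(\<Sum>i\<le>k. x i * y (k - i)) = (\<Sum>i\<le>n. x i * (if i \<le> k then y (k - i) else 0))"
  using assms by (intro sum.mono_neutral_cong_left) auto

lemma sum_convolution_le:
  fixes x y :: "nat \<Rightarrow> real"
  assumes "\<And>k. 0 \<le> x k" "\<And>k. 0 \<le> y k"
  shows "(\<Sum>k\<le>n. \<Sum>i\<le>k. x i * y (k - i)) \<le> (\<Sum>i\<le>n. x i) * (\<Sum>k\<le>n. y k)"
proof -
  have "(\<Sum>k\<le>n. \<Sum>i\<le>k. x i * y (k - i)) = (\<Sum>k\<le>n. \<Sum>i\<le>n. x i * (if i \<le> k then y (k - i) else 0))"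
    by (intro sum.cong convolution_extend) auto
  also have "\<dots> = (\<Sum>i\<le>n. x i * (\<Sum>k\<le>n. if i \<le> k then y (k - i) else 0))"
    by (subst sum.swap) (simp add: sum_distrib_left)
  also have "\<dots> \<le> (\<Sum>i\<le>n. x i * (\<Sum>k\<le>n. y k))"
    using assms by (intro sum_mono mult_left_mono sum_shift_le) auto
  finally show ?thesis by (simp add: sum_distrib_right)
qed

text \<open>Young's inequality for l1 and l2: the convolution is the sum over i of x_i times the
  shift of y by i, a shift does not increase the norm of a truncation, and Minkowski's inequality
  adds up the pieces.\<close>

lemma L2_set_convolution_le:
  fixes x y :: "nat \<Rightarrow> real"
  assumes "\<And>k. 0 \<le> x k" "\<And>k. 0 \<le> y k"
  shows "L2_set (\<lambda>k. \<Sum>i\<le>k. x i * y (k - i)) {..n} \<le> (\<Sum>i\<le>n. x i) * L2_set y {..n}"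
proof -
  have "L2_set (\<lambda>k. \<Sum>i\<le>k. x i * y (k - i)) {..n} =
      L2_set (\<lambda>k. \<Sum>i\<le>n. x i * (if i \<le> k then y (k - i) else 0)) {..n}"
    by (intro L2_set_cong convolution_extend) auto
  also have "\<dots> \<le> (\<Sum>i\<le>n. L2_set (\<lambda>k. x i * (if i \<le> k then y (k - i) else 0)) {..n})"
    by (rule L2_set_sum_le) simp
  also have "\<dots> = (\<Sum>i\<le>n. x i * L2_set (\<lambda>k. if i \<le> k then y (k - i) else 0) {..n})"
    using assms by (simp add: L2_set_right_distrib)
  also have "\<dots> \<le> (\<Sum>i\<le>n. x i * L2_set y {..n})"
    using assms by (intro sum_mono mult_left_mono L2_set_shift_le) auto
  finally show ?thesis by (simp add: sum_distrib_right)
qed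

lemma norm_fps_mult_nth_le:
  fixes F G :: "complex fps"
  shows "cmod (fps_nth (F * G) k) \<le> (\<Sum>i\<le>k. cmod (fps_nth F i) * cmod (fps_nth G (k - i)))"
  unfolding fps_mult_nth atLeast0AtMost
  by (rule order_trans[OF norm_sum]) (simp add: norm_mult)

lemma l1_bounded_mult:
  assumes "l1_bounded F C" "l1_bounded G D"
  shows "l1_bounded (F * G) (C * D)"
  unfolding l1_bounded_def
proof
  fix n
  have "(\<Sum>k\<le>n. cmod (fps_nth (F * G) k)) \<le> (\<Sum>k\<le>n. \<Sum>i\<le>k. cmod (fps_nth F i) * cmod (fps_nth G (k - i)))"
    by (intro sum_mono norm_fps_mult_nth_le)
  also have "\<dots> \<le> (\<Sum>k\<le>n. cmod (fps_nth F k)) * (\<Sum>k\<le>n. cmod (fps_nth G k))"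
    by (rule sum_convolution_le) auto
  also have "\<dots> \<le> C * D"
    by (intro mult_mono l1_boundedD assms l1_bounded_nonneg[OF assms(1)] sum_nonneg) simp_all
  finally show "(\<Sum>k\<le>n. cmod (fps_nth (F * G) k)) \<le> C * D" .
qed

text \<open>For \<gamma> \<ge> 0 one has i + j + 1 \<le> 2 (max i j + 1) and 2^\<gamma> \<le> 2; for
  \<gamma> < 0 the weight decreases. This lets the weight of a product fall on one factor at a
  time.\<close>

lemma powr_add_le_sum:
  fixes i j :: nat
  assumes "\<gamma> \<le> 1/2"
  shows "(real (i + j) + 1) powr \<gamma> \<le> 2 * ((real i + 1) powr \<gamma> + (real j + 1) powr \<gamma>)"
proof (cases "\<gamma> \<ge> 0")
  case True
  define m where "m = max i j"
  have "(real (i + j) + 1) powr \<gamma> \<le> (2 * (real m + 1)) powr \<gamma>"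
    using True by (intro powr_mono2) (auto simp: m_def)
  also have "\<dots> \<le> 2 powr 1 * (real m + 1) powr \<gamma>"
    unfolding powr_mult using assms by (intro mult_right_mono powr_mono) auto
  also have "\<dots> \<le> 2 * ((real i + 1) powr \<gamma> + (real j + 1) powr \<gamma>)"
    by (auto simp: m_def max_def)
  finally show ?thesis .
next
  case False
  then have "(real (i + j) + 1) powr \<gamma> \<le> (real i + 1) powr \<gamma>"
    by (intro powr_mono2') auto
  also have "\<dots> \<le> 2 * ((real i + 1) powr \<gamma> + (real j + 1) powr \<gamma>)"
    by (simp add: add_increasing2)
  finally show ?thesis .
qed

text \<open>Splitting the weight over the two factors leaves two convolutions, each of an l1
  sequence with a weighted l2 sequence, to which Young's inequality applies.\<close>

lemma wl2_bounded_mult: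
  assumes \<gamma>: "\<gamma> \<le> 1/2"
    and "l1_bounded F A" "l1_bounded G A'" "wl2_bounded \<gamma> F B" "wl2_bounded \<gamma> G B'"
  shows "wl2_bounded \<gamma> (F * G) (2 * (A' * B + A * B'))"
  unfolding wl2_bounded_def
proof
  fix n
  define x y where "x k = cmod (fps_nth F k)" and "y k = cmod (fps_nth G k)" for k
  define w where "w k = (real k + 1) powr \<gamma>" for k
  have le: "w k * cmod (fps_nth (F * G) k) \<le>
      2 * (\<Sum>i\<le>k. y i * (w (k - i) * x (k - i))) + 2 * (\<Sum>i\<le>k. x i * (w (k - i) * y (k - i)))" for k
  proof -
    have "w k * cmod (fps_nth (F * G) k) \<le> w k * (\<Sum>i\<le>k. x i * y (k - i))"
      unfolding x_def y_def by (intro mult_left_mono norm_fps_mult_nth_le) (simp add: w_def)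
    also have "\<dots> = (\<Sum>i\<le>k. w k * (x i * y (k - i)))"
      by (rule sum_distrib_left)
    also have "\<dots> \<le> (\<Sum>i\<le>k. 2 * (w i + w (k - i)) * (x i * y (k - i)))"
    proof (intro sum_mono mult_right_mono)
      fix i assume "i \<in> {..k}"
      then show "w k \<le> 2 * (w i + w (k - i))"
        using powr_add_le_sum[OF \<gamma>, of i "k - i"] by (simp add: w_def)
    qed (simp add: x_def y_def)
    also have "\<dots> = 2 * (\<Sum>i\<le>k. w i * x i * y (k - i)) + 2 * (\<Sum>i\<le>k. x i * (w (k - i) * y (k - i)))"
      by (simp add: sum_distrib_left sum.distrib algebra_simps)
    \<comment> \<open>The reflection of i to k - i moves the weighted sequence to the second place,
      as \<open>L2_set_convolution_le\<close> expects.\<close>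
    also have "(\<Sum>i\<le>k. w i * x i * y (k - i)) = (\<Sum>i\<le>k. y i * (w (k - i) * x (k - i)))"
      by (rule sum.reindex_bij_witness[of _ "\<lambda>i. k - i" "\<lambda>i. k - i"]) auto
    finally show ?thesis .
  qed
  have nn: "0 \<le> x k" "0 \<le> y k" "0 \<le> w k" for k
    by (auto simp: x_def y_def w_def)
  have Bx: "L2_set (\<lambda>k. w k * x k) {..n} \<le> B" and By: "L2_set (\<lambda>k. w k * y k) {..n} \<le> B'"
    using assms(4,5)[THEN wl2_boundedD, of n] by (simp_all add: w_def x_def y_def)
  have Ax: "(\<Sum>k\<le>n. x k) \<le> A" and Ay: "(\<Sum>k\<le>n. y k) \<le> A'"
    using assms(2,3)[THEN l1_boundedD, of n] by (simp_all add: x_def y_def)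
  have "L2_set (\<lambda>k. w k * cmod (fps_nth (F * G) k)) {..n} \<le>
      L2_set (\<lambda>k. 2 * (\<Sum>i\<le>k. y i * (w (k - i) * x (k - i))) + 2 * (\<Sum>i\<le>k. x i * (w (k - i) * y (k - i)))) {..n}"
    by (intro L2_set_mono le) (simp add: nn)
  also have "\<dots> \<le> 2 * L2_set (\<lambda>k. \<Sum>i\<le>k. y i * (w (k - i) * x (k - i))) {..n} +
      2 * L2_set (\<lambda>k. \<Sum>i\<le>k. x i * (w (k - i) * y (k - i))) {..n}"
    by (rule order_trans[OF L2_set_triangle_ineq]) (simp add: L2_set_right_distrib)
  also have "\<dots> \<le> 2 * ((\<Sum>i\<le>n. y i) * L2_set (\<lambda>k. w k * x k) {..n}) +
      2 * ((\<Sum>i\<le>n. x i) * L2_set (\<lambda>k. w k * y k) {..n})"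
    by (intro add_mono mult_left_mono L2_set_convolution_le) (simp_all add: nn)
  also have "\<dots> \<le> 2 * (A' * B) + 2 * (A * B')"
    by (intro add_mono mult_left_mono mult_mono Bx By Ax Ay l1_bounded_nonneg[OF assms(2)]
        l1_bounded_nonneg[OF assms(3)]) simp_all
  finally show "L2_set (\<lambda>k. (real k + 1) powr \<gamma> * cmod (fps_nth (F * G) k)) {..n} \<le> 2 * (A' * B + A * B')"
    by (simp add: w_def ring_distribs)
qed

lemma wl2_bounded_of_sum:
  assumes "\<And>n. (\<Sum>k\<le>n. (real k + 1) powr \<gamma> * cmod (fps_nth F k)) \<le> C"
  shows "wl2_bounded \<gamma> F C"
  unfolding wl2_bounded_def
  by (intro allI order_trans[OF L2_set_le_sum assms]) simp

section \<open>Power series converging beyond the closed disk\<close>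

text \<open>A radius R strictly between 1 and the radius of convergence makes the coefficients
  O(R^(-k)), which beats every power of k.\<close>

lemma summable_powr_fps:
  fixes F :: "complex fps"
  assumes "fps_conv_radius F > 1"
  shows "summable (\<lambda>k. (real k + 1) powr t * cmod (fps_nth F k))"
proof -
  obtain R where R: "1 < R" "ereal R < fps_conv_radius F"
    using ereal_dense2[OF assms] by (auto simp: one_ereal_def)
  have "summable (\<lambda>k. norm (cmod (fps_nth F k * of_real R ^ k)))"
    unfolding real_norm_def abs_norm_cancel using R by (intro norm_summable_fps) auto
  moreover have "(\<lambda>k. (real k + 1) powr t * cmod (fps_nth F k)) \<in> O(\<lambda>k. cmod (fps_nth F k * of_real R ^ k))"
  proof -
    have "(\<lambda>k. (real k + 1) powr t) \<in> O(\<lambda>k. R ^ k)"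
      using R by real_asymp
    then have "(\<lambda>k. (real k + 1) powr t * cmod (fps_nth F k)) \<in> O(\<lambda>k. R ^ k * cmod (fps_nth F k))"
      by (intro landau_o.big_mult) auto
    then show ?thesis
      using R by (simp add: norm_mult norm_power mult.commute)
  qed
  ultimately show ?thesis
    by (rule summable_comparison_test_bigo)
qed

lemma l1_bounded_fps:
  assumes "fps_conv_radius F > 1"
  obtains C where "l1_bounded F C"
proof
  show "l1_bounded F (\<Sum>k. cmod (fps_nth F k))"
    unfolding l1_bounded_def
    using summable_powr_fps[OF assms, of 0] by (intro allI sum_le_suminf) auto
qed

lemma wl2_bounded_fps:
  assumes "fps_conv_radius F > 1"
  obtains C where "wl2_bounded \<gamma> F C"
proof
  show "wl2_bounded \<gamma> F (\<Sum>k. (real k + 1) powr \<gamma> * cmod (fps_nth F k))"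
    using summable_powr_fps[OF assms, of \<gamma>] by (intro wl2_bounded_of_sum sum_le_suminf) auto
qed

section \<open>Approximate inversion by polynomials in one variable\<close>

lemma ereal_less_of_le_1: "x \<le> 1 \<Longrightarrow> 1 < r \<Longrightarrow> ereal x < r"
  by (rule le_less_trans[of _ 1]) (auto simp: one_ereal_def)

text \<open>By compactness a neighbourhood of the closed disk contains a disk of radius 1 + e, on
  which the Taylor series at 0 converges to G.\<close>

lemma analytic_on_cball_imp_fps:
  assumes "G analytic_on cball 0 1"
  obtains F where "fps_conv_radius F > 1" "\<And>z. cmod z \<le> 1 \<Longrightarrow> eval_fps F z = G z"
proof -
  obtain T where T: "open T" "cball 0 1 \<subseteq> T" "G holomorphic_on T"
    using assms by (auto simp: analytic_on_holomorphic)
  obtain e where e: "e > 0" "(\<Union>x\<in>cball (0::complex) 1. ball x e) \<subseteq> T"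
    using compact_subset_open_imp_ball_epsilon_subset[OF compact_cball T(1,2)] by blast
  have "ball 0 (1 + e) \<subseteq> T"
  proof
    fix z :: complex assume z: "z \<in> ball 0 (1 + e)"
    show "z \<in> T"
    proof (cases "cmod z \<le> 1")
      case True
      then show ?thesis using T(2) by auto
    next
      case False
      \<comment> \<open>Outside the closed disk, \<open>sgn z\<close> is the point of the disk
        nearest to z.\<close>
      have "dist (sgn z) z = \<bar>1 - cmod z\<bar>"
      proof -
        have "sgn z - z = (1 - cmod z) *\<^sub>R sgn z"
          using False by (cases "z = 0") (simp_all add: sgn_div_norm algebra_simps)
        moreover have "z \<noteq> 0" using False by auto
        ultimately show ?thesis by (simp add: dist_norm norm_sgn)
      qed
      then have "z \<in> ball (sgn z) e"
        using z False by simp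
      moreover have "sgn z \<in> cball 0 1"
        by (simp add: norm_sgn)
      ultimately show ?thesis using e(2) by blast
    qed
  qed
  then have hol: "G holomorphic_on eball 0 (ereal (1 + e))"
    using T(3) holomorphic_on_subset by auto
  have "ereal 1 < ereal (1 + e)" using e by simp
  then have "fps_conv_radius (fps_expansion G 0) > 1"
    using conv_radius_fps_expansion[OF hol] by (metis less_le_trans one_ereal_def)
  moreover have "eval_fps (fps_expansion G 0) z = G z" if "cmod z \<le> 1" for z
    using eval_fps_expansion[OF hol, of z] that e by simp
  ultimately show ?thesis using that by blast
qed

lemma eval_fps_analytic_on_cball:
  fixes F :: "complex fps"
  assumes "fps_conv_radius F > 1"
  shows "eval_fps F analytic_on cball 0 1"
  by (rule analytic_on_eval_fps) (use assms in \<open>auto intro: ereal_less_of_le_1\<close>)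

lemma fps_eqI_eval:
  fixes F G :: "complex fps"
  assumes "fps_conv_radius F \<ge> 1" "fps_conv_radius G \<ge> 1"
    and "\<And>z. cmod z < 1 \<Longrightarrow> eval_fps F z = eval_fps G z"
  shows "F = G"
proof (rule fps_expansion_unique_complex)
  have pos: "fps_conv_radius F > 0" "fps_conv_radius G > 0"
    using assms by (auto intro: less_le_trans[of 0 1])
  show "eval_fps F has_fps_expansion F"
    using pos(1) by (rule eval_fps_has_fps_expansion)
  have "eventually (\<lambda>z. z \<in> ball 0 1) (nhds (0::complex))"
    by (intro eventually_nhds_in_open) auto
  then have "eventually (\<lambda>z. eval_fps G z = eval_fps F z) (nhds 0)"
    by eventually_elim (use assms in auto)
  then show "eval_fps F has_fps_expansion G"
    using pos by (simp add: has_fps_expansion_def)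
qed

lemma fps_conv_radius_mult_gt_1:
  fixes F G :: "complex fps"
  assumes "fps_conv_radius F > 1" "fps_conv_radius G > 1"
  shows "fps_conv_radius (F * G) > 1"
  using assms by (intro less_le_trans[OF _ fps_conv_radius_mult]) auto

lemma fps_nonvanishing_inverse:
  fixes F :: "complex fps"
  assumes F: "fps_conv_radius F > 1" and nz: "\<And>z. cmod z \<le> 1 \<Longrightarrow> eval_fps F z \<noteq> 0"
  obtains U where "fps_conv_radius U > 1" "U * F = 1"
proof -
  have "(\<lambda>z. inverse (eval_fps F z)) analytic_on cball 0 1"
    using nz by (intro analytic_on_inverse eval_fps_analytic_on_cball F) auto
  then obtain U where U: "fps_conv_radius U > 1" "\<And>z. cmod z \<le> 1 \<Longrightarrow> eval_fps U z = inverse (eval_fps F z)"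
    by (rule analytic_on_cball_imp_fps) blast
  have "U * F = 1"
  proof (rule fps_eqI_eval)
    fix z :: complex assume z: "cmod z < 1"
    then have "eval_fps (U * F) z = eval_fps U z * eval_fps F z"
      using U(1) F by (intro eval_fps_mult) (auto intro: ereal_less_of_le_1)
    then show "eval_fps (U * F) z = eval_fps 1 z"
      using U(2)[of z] nz[of z] z by simp
  qed (use fps_conv_radius_mult_gt_1[OF U(1) F] in auto)
  then show ?thesis using U that by blast
qed

section \<open>Approximate inverses of products, linear factors and nonvanishing functions\<close>

text \<open>The degree bound d n rather than n leaves room for degrees to add up under products. The
  l1 norm of the error has only to be bounded, the weighted one has to decay at the optimal rate;
  asking for both makes the notion multiplicative.\<close>

definition approx_invertible :: "real \<Rightarrow> complex fps \<Rightarrow> bool" where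
  "approx_invertible \<beta> F \<longleftrightarrow> (\<exists>C d. \<forall>n. \<exists>P. (\<forall>k>d * n. fps_nth P k = 0) \<and>
     l1_bounded (1 - P * F) C \<and> wl2_bounded (\<beta>/2) (1 - P * F) (C / sqrt (psum \<beta> n)))"

lemma l1_bounded_mono: "l1_bounded F C \<Longrightarrow> C \<le> D \<Longrightarrow> l1_bounded F D"
  unfolding l1_bounded_def using order_trans by blast

lemma wl2_bounded_mono: "wl2_bounded \<gamma> F C \<Longrightarrow> C \<le> D \<Longrightarrow> wl2_bounded \<gamma> F D"
  unfolding wl2_bounded_def using order_trans by blast

lemma approx_invertible_mult:
  assumes "\<beta> \<le> 1" "approx_invertible \<beta> F" "approx_invertible \<beta> G"
  shows "approx_invertible \<beta> (F * G)"
proof -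
  obtain C d where 1: "\<And>n. \<exists>P. (\<forall>k>d * n. fps_nth P k = 0) \<and>
     l1_bounded (1 - P * F) C \<and> wl2_bounded (\<beta>/2) (1 - P * F) (C / sqrt (psum \<beta> n))"
    using assms(2) unfolding approx_invertible_def by blast
  obtain C' d' where 2: "\<And>n. \<exists>P. (\<forall>k>d' * n. fps_nth P k = 0) \<and>
     l1_bounded (1 - P * G) C' \<and> wl2_bounded (\<beta>/2) (1 - P * G) (C' / sqrt (psum \<beta> n))"
    using assms(3) unfolding approx_invertible_def by blast
  \<comment> \<open>The constant 4 comes from \<open>wl2_bounded_mult\<close>: the weighted norm of
    the product of the errors is at most 2 (C' C/s + C C'/s). The same D dominates the l1 bound C +
    C' + C C'.\<close>
  define D where "D = C + C' + 4 * C * C'"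
  have "\<exists>P. (\<forall>k>(d + d') * n. fps_nth P k = 0) \<and> l1_bounded (1 - P * (F * G)) D \<and>
      wl2_bounded (\<beta>/2) (1 - P * (F * G)) (D / sqrt (psum \<beta> n))" for n
  proof -
    define s where "s = sqrt (psum \<beta> n)"
    obtain P where P: "\<And>k. k > d * n \<Longrightarrow> fps_nth P k = 0"
        "l1_bounded (1 - P * F) C" "wl2_bounded (\<beta>/2) (1 - P * F) (C / s)"
      using 1[of n] by (auto simp: s_def)
    obtain Q where Q: "\<And>k. k > d' * n \<Longrightarrow> fps_nth Q k = 0"
        "l1_bounded (1 - Q * G) C'" "wl2_bounded (\<beta>/2) (1 - Q * G) (C' / s)"
      using 2[of n] by (auto simp: s_def)
    have eq: "1 - (P * Q) * (F * G) = (1 - P * F) + (1 - Q * G) + - ((1 - P * F) * (1 - Q * G))"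
      by (simp add: algebra_simps)
    have nn: "C \<ge> 0" "C' \<ge> 0"
      using P(2) Q(2) l1_bounded_nonneg by auto
    have "fps_nth (P * Q) k = 0" if "k > (d + d') * n" for k
    proof -
      have "i > d * n \<or> k - i > d' * n" if "i \<le> k" for i
        using \<open>k > (d + d') * n\<close> that unfolding distrib_right by linarith
      then have "fps_nth P i * fps_nth Q (k - i) = 0" if "i \<le> k" for i
        using P(1) Q(1) that by fastforce
      then show ?thesis
        unfolding fps_mult_nth by (intro sum.neutral) auto
    qed
    moreover have "l1_bounded (1 - (P * Q) * (F * G)) (C + C' + C * C')"
      unfolding eq by (intro l1_bounded_add) (auto simp: P Q intro!: l1_bounded_mult)
    then have "l1_bounded (1 - (P * Q) * (F * G)) D"
      by (rule l1_bounded_mono) (use nn in \<open>simp add: D_def\<close>)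
    moreover have "wl2_bounded (\<beta>/2) (1 - (P * Q) * (F * G))
        (C / s + C' / s + 2 * (C' * (C / s) + C * (C' / s)))"
      unfolding eq using assms(1)
      unfolding wl2_bounded_uminus by (intro wl2_bounded_add wl2_bounded_mult P Q iffD2[OF wl2_bounded_uminus]) simp
    then have "wl2_bounded (\<beta>/2) (1 - (P * Q) * (F * G)) (D / s)"
      by (rule wl2_bounded_mono) (simp add: D_def add_divide_distrib mult_ac)
    ultimately show ?thesis unfolding s_def by blast
  qed
  then show ?thesis unfolding approx_invertible_def by blast
qed

lemma approx_invertible_linear:
  assumes "cmod c = 1"
  shows "approx_invertible \<beta> (1 - fps_const c * fps_X)"
proof -
  have "\<exists>P. (\<forall>k>1 * n. fps_nth P k = 0) \<and> l1_bounded (1 - P * (1 - fps_const c * fps_X)) 1 \<and>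
      wl2_bounded (\<beta>/2) (1 - P * (1 - fps_const c * fps_X)) (1 / sqrt (psum \<beta> n))" for n
  proof -
    define S where "S = psum \<beta> n"
    define w where "w k = (real k + 1) powr (-\<beta>) / S" for k
    have S: "S > 0" by (simp add: S_def)
    \<comment> \<open>\<open>P\<close> is the quotient (1 - E) / (1 - c z). Dividing by 1 - c z
      forms partial sums, twisted by c^k, and those of 1 - E are 1 - psum \<beta> k / S. This
      vanishes at k = n, so cutting off there creates no stray term at n + 1.\<close>
    define P where "P = Abs_fps (\<lambda>k. if k \<le> n then c ^ k * of_real (1 - psum \<beta> k / S) else 0)"
    define E where "E = Abs_fps (\<lambda>k. if k \<le> n then c ^ k * of_real (w k) else 0)"
    have psum_Suc: "psum \<beta> (Suc k) / S = psum \<beta> k / S + w (Suc k)" for k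
      by (simp add: psum_def w_def add_divide_distrib add_ac)
    have "1 - P * (1 - fps_const c * fps_X) = E"
    proof (rule fps_ext)
      fix k
      have "P * (1 - fps_const c * fps_X) = P - fps_const c * (fps_X * P)"
        by (simp add: algebra_simps)
      then have nth: "fps_nth (1 - P * (1 - fps_const c * fps_X)) k =
          fps_nth 1 k - (fps_nth P k - c * (if k = 0 then 0 else fps_nth P (k - 1)))"
        by simp
      show "fps_nth (1 - P * (1 - fps_const c * fps_X)) k = fps_nth E k"
      proof (cases k)
        case 0
        then show ?thesis
          unfolding nth by (simp add: P_def E_def psum_def w_def)
      next
        case (Suc m)
        consider "k \<le> n" | "k = Suc n" | "k > Suc n" by linarith
        then show ?thesis
        proof cases
          case 1
          then show ?thesis
            unfolding nth using Suc by (simp add: P_def E_def psum_Suc algebra_simps)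
        next
          case 2
          then show ?thesis
            unfolding nth using S by (simp add: P_def E_def flip: S_def)
        next
          case 3
          then show ?thesis
            unfolding nth by (auto simp: P_def E_def)
        qed
      qed
    qed
    moreover have "l1_bounded E 1"
      unfolding l1_bounded_def
    proof
      fix m
      have "(\<Sum>k\<le>m. cmod (fps_nth E k)) = (\<Sum>k\<in>{..m} \<inter> {..n}. w k)"
        by (rule sum.mono_neutral_cong_right)
          (use S assms in \<open>auto simp: E_def norm_mult norm_power w_def simp flip: of_real_divide\<close>)
      also have "\<dots> \<le> (\<Sum>k\<le>n. w k)"
        using S by (intro sum_mono2) (auto simp: w_def)
      also have "\<dots> = 1"
        using S by (simp add: w_def flip: sum_divide_distrib) (simp add: S_def psum_def)
      finally show "(\<Sum>k\<le>m. cmod (fps_nth E k)) \<le> 1" .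
    qed
    moreover have "wl2_bounded (\<beta>/2) E (1 / sqrt S)"
      unfolding wl2_bounded_def
    proof
      fix m
      \<comment> \<open>The weight cancels one of the two factors (k+1)^(-\<beta>), so the squares
        are again proportional to \<open>w\<close>, whose total is 1; this yields the squared norm 1
        / S.\<close>
      have sq: "((real k + 1) powr (\<beta>/2) * w k)\<^sup>2 = w k / S" for k
      proof -
        have "((real k + 1) powr (\<beta>/2))\<^sup>2 = (real k + 1) powr \<beta>"
          by (simp add: power2_eq_square flip: powr_add)
        then show ?thesis
          using S by (simp add: w_def power_mult_distrib power2_eq_square powr_minus field_simps)
      qed
      have "(\<Sum>k\<le>m. ((real k + 1) powr (\<beta>/2) * cmod (fps_nth E k))\<^sup>2) = (\<Sum>k\<in>{..m} \<inter> {..n}. w k / S)"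
      proof (rule sum.mono_neutral_cong_right)
        fix k assume "k \<in> {..m} \<inter> {..n}"
        then have "cmod (fps_nth E k) = w k"
          using S assms by (auto simp: E_def norm_mult norm_power w_def simp flip: of_real_divide)
        then show "((real k + 1) powr (\<beta>/2) * cmod (fps_nth E k))\<^sup>2 = w k / S"
          by (simp only: sq)
      qed (auto simp: E_def)
      also have "\<dots> \<le> (\<Sum>k\<le>n. w k / S)"
        using S by (intro sum_mono2) (auto simp: w_def)
      also have "\<dots> = 1 / S"
        using S by (simp add: w_def flip: sum_divide_distrib) (simp add: S_def psum_def)
      finally show "L2_set (\<lambda>k. (real k + 1) powr (\<beta>/2) * cmod (fps_nth E k)) {..m} \<le> 1 / sqrt S"
        unfolding L2_set_def using real_sqrt_le_mono by (fastforce simp: real_sqrt_divide)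
    qed
    moreover have "fps_nth P k = 0" if "k > n" for k
      using that by (simp add: P_def)
    ultimately show ?thesis
      unfolding S_def by auto
  qed
  then show ?thesis
    unfolding approx_invertible_def by blast
qed

text \<open>The cut-off series has only indices k > n, where sqrt (psum \<beta> n) is at most
  (k+1)^(1 + \<bar>\<beta>\<bar>). The rate is thus absorbed into one more power of k, and the
  coefficients remain summable.\<close>

lemma fps_tail_sum_le:
  fixes U :: "complex fps"
  assumes U: "fps_conv_radius U > 1"
  obtains C where "C \<ge> 0" "\<And>n m. (\<Sum>k\<le>m. (real k + 1) powr t * cmod (fps_nth (U - fps_cutoff (Suc n) U) k)) \<le> C / sqrt (psum \<beta> n)"
proof
  define g where "g k = (real k + 1) powr (t + (1 + \<bar>\<beta>\<bar>)) * cmod (fps_nth U k)" for k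
  have sg: "summable g"
    unfolding g_def by (rule summable_powr_fps[OF U])
  have g0: "0 \<le> g k" for k
    by (simp add: g_def)
  show "0 \<le> suminf g" using sg g0 by (rule suminf_nonneg)
  fix n m
  have "(real k + 1) powr t * cmod (fps_nth (U - fps_cutoff (Suc n) U) k) \<le> g k / sqrt (psum \<beta> n)" for k
  proof (cases "k \<le> n")
    case True
    then show ?thesis using g0 by (simp add: less_eq_real_def[of 0 "psum \<beta> n"])
  next
    case False
    have "sqrt (psum \<beta> n) \<le> psum \<beta> n"
      using psum_ge_1[of \<beta> n] by (intro real_le_lsqrt) (auto simp: power2_eq_square)
    also have "\<dots> \<le> psum \<beta> k"
      using False by (intro psum_mono) auto
    also have "\<dots> \<le> (real k + 1) powr (1 + \<bar>\<beta>\<bar>)"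
      by (rule psum_le_powr)
    finally have "(real k + 1) powr t * cmod (fps_nth U k) * sqrt (psum \<beta> n) \<le>
        (real k + 1) powr t * cmod (fps_nth U k) * (real k + 1) powr (1 + \<bar>\<beta>\<bar>)"
      by (intro mult_left_mono) auto
    also have "\<dots> = g k"
      by (simp add: g_def powr_add)
    finally show ?thesis
      using False by (simp add: pos_le_divide_eq)
  qed
  then have "(\<Sum>k\<le>m. (real k + 1) powr t * cmod (fps_nth (U - fps_cutoff (Suc n) U) k)) \<le>
      (\<Sum>k\<le>m. g k) / sqrt (psum \<beta> n)"
    unfolding sum_divide_distrib by (intro sum_mono)
  also have "\<dots> \<le> suminf g / sqrt (psum \<beta> n)"
    using sg g0 by (intro divide_right_mono sum_le_suminf) (auto simp: less_imp_le)
  finally show "(\<Sum>k\<le>m. (real k + 1) powr t * cmod (fps_nth (U - fps_cutoff (Suc n) U) k)) \<le>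
      suminf g / sqrt (psum \<beta> n)" .
qed

text \<open>With U = 1/F and P its truncation, the error 1 - P F is the tail of U times F, so
  smallness of the tail in both norms carries over by the product estimates.\<close>

lemma approx_invertible_nonvanishing:
  assumes \<beta>: "\<beta> \<le> 1" and F: "fps_conv_radius F > 1" and nz: "\<And>z. cmod z \<le> 1 \<Longrightarrow> eval_fps F z \<noteq> 0"
  shows "approx_invertible \<beta> F"
proof -
  obtain U where U: "fps_conv_radius U > 1" "U * F = 1"
    using fps_nonvanishing_inverse[OF F nz] by blast
  obtain A where A: "l1_bounded F A" using l1_bounded_fps[OF F] .
  obtain B where B: "wl2_bounded (\<beta>/2) F B" using wl2_bounded_fps[OF F] .
  obtain C where C: "C \<ge> 0" "\<And>n m. (\<Sum>k\<le>m. (real k + 1) powr 0 *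
      cmod (fps_nth (U - fps_cutoff (Suc n) U) k)) \<le> C / sqrt (psum \<beta> n)"
    using fps_tail_sum_le[OF U(1), of 0 \<beta>] by blast
  obtain D where D: "D \<ge> 0" "\<And>n m. (\<Sum>k\<le>m. (real k + 1) powr (\<beta>/2) *
      cmod (fps_nth (U - fps_cutoff (Suc n) U) k)) \<le> D / sqrt (psum \<beta> n)"
    using fps_tail_sum_le[OF U(1), of "\<beta>/2" \<beta>] by blast
  \<comment> \<open>One constant for both norms: C A bounds the l1 norm of the error because s \<ge>
    1, the other summand is the bound of \<open>wl2_bounded_mult\<close>.\<close>
  define K where "K = C * A + 2 * (A * D + C * B)"
  have nn: "A \<ge> 0" "B \<ge> 0"
    using A B l1_bounded_nonneg wl2_bounded_nonneg by auto
  have "\<exists>P. (\<forall>k>1 * n. fps_nth P k = 0) \<and> l1_bounded (1 - P * F) K \<and>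
      wl2_bounded (\<beta>/2) (1 - P * F) (K / sqrt (psum \<beta> n))" for n
  proof -
    define s where "s = sqrt (psum \<beta> n)"
    define V where "V = U - fps_cutoff (Suc n) U"
    have s: "s \<ge> 1" using psum_ge_1[of \<beta> n] by (simp add: s_def)
    have eq: "1 - fps_cutoff (Suc n) U * F = V * F"
      by (simp add: V_def left_diff_distrib U(2))
    have l1V: "l1_bounded V (C / s)"
      using C(2)[of n] by (simp add: l1_bounded_def V_def s_def del: fps_sub_nth fps_cutoff_nth)
    have wV: "wl2_bounded (\<beta>/2) V (D / s)"
      using D(2)[of n] by (intro wl2_bounded_of_sum) (simp add: V_def s_def)
    have "l1_bounded (V * F) (C / s * A)"
      by (rule l1_bounded_mult[OF l1V A])
    moreover have "C / s * A \<le> K"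
    proof -
      have "C / s * A \<le> C * A"
        using s nn C(1) by (intro mult_right_mono) (auto simp: divide_le_eq mult_le_cancel_left1)
      then show ?thesis using nn C(1) D(1) by (simp add: K_def add_increasing2)
    qed
    ultimately have "l1_bounded (V * F) K"
      by (rule l1_bounded_mono)
    moreover have "wl2_bounded (\<beta>/2) (V * F) (2 * (A * (D / s) + C / s * B))"
      using \<beta> by (intro wl2_bounded_mult l1V wV A B) auto
    then have "wl2_bounded (\<beta>/2) (V * F) (K / s)"
      by (rule wl2_bounded_mono)
        (use nn C(1) s in \<open>simp add: K_def add_divide_distrib\<close>)
    moreover have "\<forall>k>1 * n. fps_nth (fps_cutoff (Suc n) U) k = 0"
      by simp
    ultimately show ?thesis unfolding s_def eq[symmetric] by blast
  qed
  then show ?thesis unfolding approx_invertible_def by blast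
qed

lemma approx_invertible_1: "\<beta> \<le> 1 \<Longrightarrow> approx_invertible \<beta> 1"
  by (rule approx_invertible_nonvanishing) auto

lemma approx_invertible_power:
  "\<beta> \<le> 1 \<Longrightarrow> approx_invertible \<beta> F \<Longrightarrow> approx_invertible \<beta> (F ^ m)"
  by (induction m) (auto intro: approx_invertible_1 approx_invertible_mult)

section \<open>Splitting off zeros on the unit circle\<close>

lemma finite_zeros_cball:
  fixes F :: "complex fps"
  assumes F: "fps_conv_radius F > 1" and nz: "eval_fps F 0 \<noteq> 0"
  shows "finite {z \<in> cball 0 1. eval_fps F z = 0}"
proof (cases "eval_fps F constant_on eball 0 (fps_conv_radius F)")
  case True
  have "eval_fps F z = eval_fps F 0" if "cmod z \<le> 1" for z
  proof -
    have "z \<in> eball 0 (fps_conv_radius F)" "0 \<in> eball (0::complex) (fps_conv_radius F)"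
      using that F ereal_less_of_le_1[of "cmod z"] ereal_less_of_le_1[of 0] by auto
    with True show ?thesis by (metis constant_on_def)
  qed
  then have "{z \<in> cball 0 1. eval_fps F z = 0} = {}"
    using nz by (metis (mono_tags, lifting) Collect_empty_eq mem_cball_0)
  then show ?thesis by (simp only: finite.emptyI)
next
  case False
  then show ?thesis
    using F by (intro holomorphic_compact_finite_zeros[of _ "eball 0 (fps_conv_radius F)"] holomorphic_on_eval_fps)
      (auto intro: ereal_less_of_le_1)
qed

text \<open>The whole multiplicity is removed at once, so that \<zeta> is no longer a zero of the
  cofactor and the number of distinct zeros drops. The normalisation 1 - z/\<zeta> is the one of
  \<open>approx_invertible_linear\<close>, with c = 1/\<zeta>.\<close>

lemma factor_zero:
  fixes F :: "complex fps"
  assumes F: "fps_conv_radius F > 1" and nz: "eval_fps F 0 \<noteq> 0"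
    and \<zeta>: "cmod \<zeta> = 1" "eval_fps F \<zeta> = 0"
  obtains m H where "fps_conv_radius H > 1" "F = (1 - fps_const (1 / \<zeta>) * fps_X) ^ m * H"
    "\<And>z. cmod z \<le> 1 \<Longrightarrow> eval_fps H z = 0 \<longleftrightarrow> z \<noteq> \<zeta> \<and> eval_fps F z = 0"
proof -
  define S where "S = eball (0::complex) (fps_conv_radius F)"
  define f where "f = eval_fps F"
  have S: "open S" "connected S" by (auto simp: S_def)
  have inS: "z \<in> S" if "cmod z \<le> 1" for z
    using that F by (auto simp: S_def intro: ereal_less_of_le_1)
  have hol: "f holomorphic_on S"
    unfolding f_def by (rule holomorphic_on_eval_fps) (auto simp: S_def)
  have nc: "\<not> f constant_on S"
    using nz \<zeta> inS[of 0] inS[of \<zeta>] unfolding constant_on_def f_def by (metis norm_zero zero_le_one order_refl)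
  obtain g r m where g: "0 < m" "0 < r" "ball \<zeta> r \<subseteq> S" "g holomorphic_on ball \<zeta> r"
      "\<And>w. w \<in> ball \<zeta> r \<Longrightarrow> f w = (w - \<zeta>) ^ m * g w" "\<And>w. w \<in> ball \<zeta> r \<Longrightarrow> g w \<noteq> 0"
    by (rule holomorphic_factor_zero_nonconstant[OF hol S _ _ nc, of \<zeta>])
      (use \<zeta> inS[of \<zeta>] in \<open>auto simp: f_def\<close>)
  \<comment> \<open>The value at \<zeta> removes the singularity: w - \<zeta> = -\<zeta> (1 -
    w/\<zeta>), so replacing one normalisation by the other turns g into (-\<zeta>)^m g. Near
    \<zeta> the function is holomorphic as this multiple of g, elsewhere as a quotient, and the two
    open sets cover the closed disk.\<close>
  define h where "h w = (if w = \<zeta> then (-\<zeta>) ^ m * g \<zeta> else f w / (1 - w / \<zeta>) ^ m)" for w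
  have \<zeta>0: "\<zeta> \<noteq> 0" using \<zeta> by auto
  have lin: "w - \<zeta> = (-\<zeta>) * (1 - w / \<zeta>)" for w
    using \<zeta>0 by (simp add: field_simps)
  have h_g: "h w = (-\<zeta>) ^ m * g w" if "w \<in> ball \<zeta> r" for w
  proof (cases "w = \<zeta>")
    case False
    then have "1 - w / \<zeta> \<noteq> 0" using \<zeta>0 by auto
    then show ?thesis
      using False g(5)[OF that] unfolding lin power_mult_distrib by (simp add: h_def)
  qed (simp add: h_def)
  have "h holomorphic_on ball \<zeta> r"
    by (rule holomorphic_transform[of "\<lambda>w. (-\<zeta>) ^ m * g w"]) (auto intro!: holomorphic_intros g simp: h_g)
  moreover have "h holomorphic_on S - {\<zeta>}"
  proof (rule holomorphic_transform[of "\<lambda>w. f w / (1 - w / \<zeta>) ^ m"])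
    show "(\<lambda>w. f w / (1 - w / \<zeta>) ^ m) holomorphic_on S - {\<zeta>}"
      by (intro holomorphic_intros holomorphic_on_subset[OF hol]) (use \<zeta>0 in auto)
  qed (auto simp: h_def)
  ultimately have "h holomorphic_on ball \<zeta> r \<union> (S - {\<zeta>})"
    using S by (intro holomorphic_on_Un) auto
  then have "h analytic_on ball \<zeta> r \<union> (S - {\<zeta>})"
    using S by (subst analytic_on_open) auto
  then have "h analytic_on cball 0 1"
    by (rule analytic_on_subset) (use inS g(2) in auto)
  then obtain H where H: "fps_conv_radius H > 1" "\<And>z. cmod z \<le> 1 \<Longrightarrow> eval_fps H z = h z"
    by (rule analytic_on_cball_imp_fps) blast
  define p where "p = [:1, - (1 / \<zeta>):]"
  have p: "1 - fps_const (1 / \<zeta>) * fps_X = fps_of_poly p"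
    by (simp add: p_def fps_of_poly_pCons)
  have fh: "f z = (1 - z / \<zeta>) ^ m * h z" for z
    using \<zeta> \<zeta>0 g(1) by (cases "z = \<zeta>") (auto simp: h_def f_def)
  have "F = fps_of_poly (p ^ m) * H"
  proof (rule fps_eqI_eval)
    show "fps_conv_radius (fps_of_poly (p ^ m) * H) \<ge> 1"
      using fps_conv_radius_mult_gt_1[OF _ H(1), of "fps_of_poly (p ^ m)"] by simp
    fix z :: complex assume z: "cmod z < 1"
    then have "eval_fps (fps_of_poly (p ^ m) * H) z = eval_fps (fps_of_poly (p ^ m)) z * eval_fps H z"
      using H(1) by (intro eval_fps_mult) (auto intro: ereal_less_of_le_1)
    also have "\<dots> = f z"
      using H(2)[of z] z by (simp add: p_def fh)
    finally show "eval_fps F z = eval_fps (fps_of_poly (p ^ m) * H) z"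
      by (simp add: f_def)
  qed (use F in auto)
  then have "F = (1 - fps_const (1 / \<zeta>) * fps_X) ^ m * H"
    unfolding p by (simp add: fps_of_poly_power)
  moreover have "eval_fps H z = 0 \<longleftrightarrow> z \<noteq> \<zeta> \<and> eval_fps F z = 0" if "cmod z \<le> 1" for z
    using H(2)[OF that] \<zeta>0 g(2,6) by (auto simp: h_def f_def)
  ultimately show ?thesis
    using that H(1) by blast
qed

text \<open>Induction on the number of distinct zeros in the closed disk, all of which lie on the
  circle. Once none is left, 1/F is analytic beyond the closed disk.\<close>

lemma approx_invertible_zero_free:
  assumes \<beta>: "\<beta> \<le> 1" and F: "fps_conv_radius F > 1"
    and nz: "\<And>z. cmod z < 1 \<Longrightarrow> eval_fps F z \<noteq> 0"
  shows "approx_invertible \<beta> F"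
  using F nz
proof (induction "card {z \<in> cball 0 1. eval_fps F z = 0}" arbitrary: F rule: less_induct)
  case less
  have fin: "finite {z \<in> cball 0 1. eval_fps F z = 0}"
    using less.prems by (intro finite_zeros_cball) auto
  show ?case
  proof (cases "\<exists>\<zeta>. cmod \<zeta> \<le> 1 \<and> eval_fps F \<zeta> = 0")
    case False
    then show ?thesis
      using \<beta> less.prems by (intro approx_invertible_nonvanishing) auto
  next
    case True
    then obtain \<zeta> where \<zeta>: "cmod \<zeta> = 1" "eval_fps F \<zeta> = 0"
      using less.prems(2) by (meson order_le_less)
    obtain m H where H: "fps_conv_radius H > 1" "F = (1 - fps_const (1 / \<zeta>) * fps_X) ^ m * H"
      and zeros: "\<And>z. cmod z \<le> 1 \<Longrightarrow> eval_fps H z = 0 \<longleftrightarrow> z \<noteq> \<zeta> \<and> eval_fps F z = 0"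
      by (rule factor_zero[OF less.prems(1) _ \<zeta>]) (use less.prems(2)[of 0] in auto)
    have "{z \<in> cball 0 1. eval_fps H z = 0} \<subset> {z \<in> cball 0 1. eval_fps F z = 0}"
    proof
      have "\<zeta> \<in> {z \<in> cball 0 1. eval_fps F z = 0}" "\<zeta> \<notin> {z \<in> cball 0 1. eval_fps H z = 0}"
        using zeros[of \<zeta>] \<zeta> by auto
      then show "{z \<in> cball 0 1. eval_fps H z = 0} \<noteq> {z \<in> cball 0 1. eval_fps F z = 0}"
        by blast
    qed (use zeros in auto)
    then have "approx_invertible \<beta> H"
      using less.hyps[of H] less.prems(2) H(1) zeros fin by (auto intro: psubset_card_mono)
    moreover have "approx_invertible \<beta> (1 - fps_const (1 / \<zeta>) * fps_X)"
      using \<zeta> by (intro approx_invertible_linear) (simp add: norm_divide)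
    ultimately show ?thesis
      unfolding H(2) using \<beta> by (intro approx_invertible_mult approx_invertible_power)
  qed
qed

section \<open>The lower bound in one variable\<close>

text \<open>A Cauchy estimate, applied with t > 1 to the decay of F and with t < 1 to the growth of
  1/F.\<close>

lemma norm_fps_nth_le:
  fixes F :: "complex fps"
  assumes "0 < t" "ereal t < fps_conv_radius F"
  obtains C where "C > 0" "\<And>k. cmod (fps_nth F k) \<le> C * (1 / t) ^ k"
proof
  have sm: "summable (\<lambda>k. cmod (fps_nth F k * of_real t ^ k))"
    using assms by (intro norm_summable_fps) auto
  let ?C = "\<Sum>k. cmod (fps_nth F k * of_real t ^ k)"
  show "?C + 1 > 0"
    using suminf_nonneg[OF sm] by simp
  fix k
  have "cmod (fps_nth F k * of_real t ^ k) \<le> ?C"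
    using sum_le_suminf[OF sm, of "{k}"] by simp
  then have "cmod (fps_nth F k) * t ^ k \<le> ?C + 1"
    using assms by (simp add: norm_mult norm_power)
  then show "cmod (fps_nth F k) \<le> (?C + 1) * (1 / t) ^ k"
    using assms by (simp add: power_divide field_simps)
qed

lemma powr_le_power:
  assumes "(s::real) > 1"
  obtains C where "C > 0" "\<And>k. (real k + 1) powr t \<le> C * s ^ k"
proof -
  have "(\<lambda>k. (real k + 1) powr t / s ^ k) \<longlonglongrightarrow> 0"
    using assms by real_asymp
  then have "Bseq (\<lambda>k. (real k + 1) powr t / s ^ k)"
    by (intro convergent_imp_Bseq) (auto simp: convergent_def)
  then obtain C where C: "C > 0" "\<And>k. \<bar>(real k + 1) powr t / s ^ k\<bar> \<le> C"
    by (auto simp: Bseq_def)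
  have "(real k + 1) powr t \<le> C * s ^ k" for k
    using C(2)[of k] assms by (simp add: field_simps)
  with C(1) that show ?thesis by blast
qed

lemma fps_conv_radius_finite_support:
  fixes P :: "complex fps"
  assumes "\<And>k. k > n \<Longrightarrow> fps_nth P k = 0"
  shows "fps_conv_radius P = \<infinity>"
proof -
  have "eventually (\<lambda>k. fps_nth P k = 0) sequentially"
    using eventually_gt_at_top[of n] by eventually_elim (rule assms)
  then have "conv_radius (fps_nth P) = conv_radius (\<lambda>_. 0 :: complex)"
    by (rule conv_radius_cong')
  then show ?thesis by (simp add: fps_conv_radius_def)
qed

text \<open>
  Neither \<open>F\<close> nor \<open>1 - P F\<close> is a polynomial, so Cauchy--Schwarz alone does not suffice. The
  coefficients beyond \<open>2 n\<close> are negligible because those of \<open>F\<close> decay geometrically while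
  those of \<open>P = (1 - E) / F\<close> grow subexponentially, uniformly in \<open>P\<close>.
\<close>

lemma wl2_lower_bound:
  fixes F :: "complex fps"
  assumes F: "fps_conv_radius F > 1" and nz: "\<And>z. cmod z < 1 \<Longrightarrow> eval_fps F z \<noteq> 0"
    and \<zeta>: "cmod \<zeta> = 1" "eval_fps F \<zeta> = 0"
  shows "eventually (\<lambda>n. \<forall>P D. (\<forall>k>n. fps_nth P k = 0) \<longrightarrow> D \<le> D0 \<longrightarrow>
    wl2_bounded (\<beta>/2) (1 - P * F) D \<longrightarrow> 1/2 \<le> D * sqrt (psum \<beta> (2 * n))) sequentially"
proof -
  obtain R where R: "1 < R" "ereal R < fps_conv_radius F"
    using ereal_dense2[OF F] by (auto simp: one_ereal_def)
  \<comment> \<open>The fourth root balances the exponents. The coefficients of P grow at most like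
    s^(2j), hence s^(2n) up to degree n; beyond index 2n they meet coefficients of F of size R^(-n)
    = s^(-4n). A decaying factor s^(-2n) remains.\<close>
  define s where "s = sqrt (sqrt R)"
  have s: "s > 1" using R by (simp add: s_def)
  have "s ^ 4 = (s ^ 2) ^ 2" by (simp flip: power_mult)
  then have s4: "s ^ 4 = R" using R by (simp add: s_def)
  obtain A where A: "A > 0" "\<And>k. cmod (fps_nth F k) \<le> A * (1 / R) ^ k"
    using norm_fps_nth_le[of R F] R by auto
  have F0: "fps_nth F 0 \<noteq> 0"
    using nz[of 0] by (simp add: eval_fps_at_0)
  define U where "U = inverse F"
  have UF: "F * U = 1"
    using inverse_mult_eq_1[OF F0] by (simp add: U_def mult.commute)
  \<comment> \<open>1/F has a pole at \<zeta>, so its series converges in the open disk only; growth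
    like s^k for a ratio s > 1 is what this allows.\<close>
  have "min 1 (fps_conv_radius F) \<le> fps_conv_radius U"
    unfolding U_def by (rule fps_conv_radius_inverse) (use nz in \<open>auto simp: one_ereal_def\<close>)
  then have "1 \<le> fps_conv_radius U" using F by (simp add: min_def split: if_splits)
  moreover have "ereal (1 / s) < 1" using s by (simp add: one_ereal_def)
  ultimately have "ereal (1 / s) < fps_conv_radius U"
    by (rule less_le_trans[rotated])
  then obtain B where B: "B > 0" "\<And>k. cmod (fps_nth U k) \<le> B * s ^ k"
    using norm_fps_nth_le[of "1 / s" U] s by auto
  obtain C1 where C1: "C1 > 0" "\<And>k. (real k + 1) powr \<bar>\<beta>/2\<bar> \<le> C1 * s ^ k"
    using powr_le_power[OF s] by blast
  obtain C2 where C2: "C2 > 0" "\<And>k. (real k + 1) powr 1 \<le> C2 * s ^ k"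
    using powr_le_power[OF s] by blast
  define K1 where "K1 = (1 + \<bar>D0\<bar> * C1) * B * C2"
  have K1: "K1 > 0" using B(1) C1(1) C2(1) by (simp add: K1_def add_pos_nonneg)
  define q where "q = 1 / R"
  have q: "0 < q" "q < 1" using R by (auto simp: q_def)
  \<comment> \<open>P is recovered as (1 - E) U. Each of the two factors contributes growth s^k,
    their convolution gives s^j with j + 1 terms, and that count is absorbed into a second s^j. The
    constant depends on P only through D0, which makes the threshold in n uniform.\<close>
  have P_le: "cmod (fps_nth P j) \<le> K1 * s ^ (2 * j)"
    if D: "D \<le> D0" "wl2_bounded (\<beta>/2) (1 - P * F) D" for P D j
  proof -
    define E where "E = 1 - P * F"
    have "cmod (fps_nth (1 - E) i) \<le> (1 + \<bar>D0\<bar> * C1) * s ^ i" for i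
    proof -
      have "(real i + 1) powr (\<beta>/2) * cmod (fps_nth E i) \<le> D"
        using member_le_L2_set[of "{..i}" i "\<lambda>k. (real k + 1) powr (\<beta>/2) * cmod (fps_nth E k)"]
          wl2_boundedD[OF D(2), of i] by (simp add: E_def)
      then have "cmod (fps_nth E i) \<le> D * (real i + 1) powr - (\<beta>/2)"
        by (simp add: powr_minus field_simps)
      also have "\<dots> \<le> \<bar>D0\<bar> * (real i + 1) powr \<bar>\<beta>/2\<bar>"
        using D(1) by (intro mult_mono powr_mono) auto
      also have "\<dots> \<le> \<bar>D0\<bar> * (C1 * s ^ i)"
        using C1(2) by (intro mult_left_mono) auto
      finally have "cmod (fps_nth E i) \<le> \<bar>D0\<bar> * C1 * s ^ i" by simp
      moreover have "cmod (fps_nth (1 - E) i) \<le> cmod (fps_nth 1 i) + cmod (fps_nth E i)"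
        by (simp add: norm_triangle_ineq4)
      moreover have "cmod (fps_nth 1 i) \<le> 1 * s ^ i"
        using s by (cases "i = 0") auto
      ultimately show ?thesis by (simp only: distrib_right)
    qed
    note E_le = this
    have "P = (1 - E) * U"
      using UF by (simp add: E_def mult.assoc)
    then have "cmod (fps_nth P j) \<le> (\<Sum>i\<le>j. cmod (fps_nth (1 - E) i) * cmod (fps_nth U (j - i)))"
      using norm_fps_mult_nth_le[of "1 - E" U j] by simp
    also have "\<dots> \<le> (\<Sum>i\<le>j. ((1 + \<bar>D0\<bar> * C1) * s ^ i) * (B * s ^ (j - i)))"
      using s C1(1) B by (intro sum_mono mult_mono E_le) auto
    also have "\<dots> = (\<Sum>i\<le>j. (1 + \<bar>D0\<bar> * C1) * B * s ^ j)"
      by (intro sum.cong refl) (simp flip: power_add)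
    also have "\<dots> = (1 + \<bar>D0\<bar> * C1) * B * s ^ j * (real j + 1) powr 1"
      by simp
    also have "\<dots> \<le> (1 + \<bar>D0\<bar> * C1) * B * s ^ j * (C2 * s ^ j)"
      using B(1) C1(1) s by (intro mult_left_mono C2(2)) auto
    also have "\<dots> = K1 * s ^ (2 * j)"
      by (simp add: K1_def mult_2 power_add)
    finally show ?thesis .
  qed
  \<comment> \<open>The total bound for the coefficients beyond 2n: n + 1 counts the coefficients of
    P, and 1/(1 - q) sums the geometric decay of F.\<close>
  have "(\<lambda>n. (real n + 1) * (K1 * A * (1 / s ^ 2) ^ n) * (1 / (1 - q))) \<longlonglongrightarrow> 0"
  proof -
    define t where "t = 1 / s ^ 2"
    have t: "0 < t" "t < 1" using s by (auto simp: t_def)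
    then have "(\<lambda>n. (real n + 1) * t ^ n) \<longlonglongrightarrow> 0"
      by real_asymp
    then have "(\<lambda>n. (K1 * A / (1 - q)) * ((real n + 1) * t ^ n)) \<longlonglongrightarrow> (K1 * A / (1 - q)) * 0"
      by (intro tendsto_mult tendsto_const)
    then show ?thesis by (simp add: t_def mult_ac)
  qed
  then have "eventually (\<lambda>n. (real n + 1) * (K1 * A * (1 / s ^ 2) ^ n) * (1 / (1 - q)) < 1/2) sequentially"
    by (rule order_tendstoD) simp
  then show ?thesis
  proof eventually_elim
    case (elim n)
    show ?case
    proof (intro allI impI)
      fix P D
      assume P: "\<forall>k>n. fps_nth P k = 0" and D: "D \<le> D0" "wl2_bounded (\<beta>/2) (1 - P * F) D"
      define E where "E = 1 - P * F"
      have radP: "fps_conv_radius P = \<infinity>"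
        using P by (intro fps_conv_radius_finite_support[of n]) auto
      then have radPF: "fps_conv_radius (P * F) > 1"
        using F by (intro fps_conv_radius_mult_gt_1) auto
      then have radE: "fps_conv_radius E > 1"
        unfolding E_def by (intro less_le_trans[OF _ fps_conv_radius_diff]) auto
      have \<zeta>_lt: "ereal (cmod \<zeta>) < r" if "r > 1" for r
        using \<zeta> that by (simp add: one_ereal_def)
      have "eval_fps E \<zeta> = eval_fps 1 \<zeta> - eval_fps (P * F) \<zeta>"
        unfolding E_def by (rule eval_fps_diff) (auto intro: \<zeta>_lt radPF)
      also have "eval_fps (P * F) \<zeta> = eval_fps P \<zeta> * eval_fps F \<zeta>"
        by (rule eval_fps_mult) (auto intro: \<zeta>_lt F simp: radP)
      finally have E\<zeta>: "eval_fps E \<zeta> = 1" using \<zeta> by simp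
      have sm: "summable (\<lambda>k. cmod (fps_nth E k))"
        using summable_powr_fps[OF radE, of 0] by simp
      have "1 \<le> (\<Sum>k. cmod (fps_nth E k))"
        using summable_norm[of "\<lambda>k. fps_nth E k * \<zeta> ^ k"] sm E\<zeta> \<zeta>
        by (simp add: eval_fps_def norm_mult norm_power)
      also have "\<dots> = (\<Sum>k. cmod (fps_nth E (k + Suc (2 * n)))) + (\<Sum>k<Suc (2 * n). cmod (fps_nth E k))"
        by (rule suminf_split_initial_segment[OF sm])
      finally have one: "1 \<le> (\<Sum>k. cmod (fps_nth E (k + Suc (2 * n)))) + (\<Sum>k\<le>2 * n. cmod (fps_nth E k))"
        by (simp add: lessThan_Suc_atMost)
      have sq: "s ^ (2 * n) * q ^ n = (1 / s ^ 2) ^ n"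
      proof -
        have "q = 1 / s ^ 2 * (1 / s ^ 2)"
          by (simp add: q_def flip: s4 power_add)
        then have "s ^ 2 * q = s ^ 2 * (1 / s ^ 2) * (1 / s ^ 2)" by (simp only: mult.assoc)
        also have "\<dots> = 1 / s ^ 2" using s by simp
        finally have "s ^ 2 * q = 1 / s ^ 2" .
        then show ?thesis by (simp add: power_mult flip: power_mult_distrib)
      qed
      have tail: "cmod (fps_nth E (k + Suc (2 * n))) \<le> (real n + 1) * (K1 * A * (1 / s ^ 2) ^ n) * q ^ k" for k
      proof -
        define l where "l = k + Suc (2 * n)"
        have "cmod (fps_nth E l) = cmod (fps_nth (P * F) l)"
          by (simp add: E_def l_def)
        also have "\<dots> \<le> (\<Sum>j\<le>l. cmod (fps_nth P j) * cmod (fps_nth F (l - j)))"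
          by (rule norm_fps_mult_nth_le)
        \<comment> \<open>Since P has degree at most n and l = k + 2n + 1, only coefficients of F
          with index above n + k enter.\<close>
        also have "\<dots> = (\<Sum>j\<le>n. cmod (fps_nth P j) * cmod (fps_nth F (l - j)))"
          using P by (intro sum.mono_neutral_right) (auto simp: l_def)
        also have "\<dots> \<le> (\<Sum>j\<le>n. (K1 * s ^ (2 * n)) * (A * q ^ (n + k)))"
        proof (intro sum_mono mult_mono)
          fix j assume j: "j \<in> {..n}"
          have "cmod (fps_nth P j) \<le> K1 * s ^ (2 * j)"
            by (rule P_le[OF D])
          also have "\<dots> \<le> K1 * s ^ (2 * n)"
            using K1 s j by (intro mult_left_mono power_increasing) auto
          finally show "cmod (fps_nth P j) \<le> K1 * s ^ (2 * n)" .
          have "cmod (fps_nth F (l - j)) \<le> A * q ^ (l - j)"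
            using A(2) by (simp add: q_def)
          also have "\<dots> \<le> A * q ^ (n + k)"
            using A(1) q j by (intro mult_left_mono power_decreasing) (auto simp: l_def)
          finally show "cmod (fps_nth F (l - j)) \<le> A * q ^ (n + k)" .
        qed (use K1 s in auto)
        also have "\<dots> = (real n + 1) * ((K1 * s ^ (2 * n)) * (A * q ^ (n + k)))"
          by simp
        also have "\<dots> = (real n + 1) * (K1 * A * (s ^ (2 * n) * q ^ n)) * q ^ k"
          by (simp add: power_add mult_ac)
        finally show ?thesis unfolding sq l_def .
      qed
      have "(\<Sum>k. cmod (fps_nth E (k + Suc (2 * n)))) \<le>
          (\<Sum>k. (real n + 1) * (K1 * A * (1 / s ^ 2) ^ n) * q ^ k)"
        using q by (intro suminf_le tail summable_ignore_initial_segment[OF sm] summable_mult summable_geometric) simp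
      also have "\<dots> = (real n + 1) * (K1 * A * (1 / s ^ 2) ^ n) * (1 / (1 - q))"
        using q by (subst suminf_mult) (simp_all add: suminf_geometric summable_geometric)
      also have "\<dots> < 1/2" by (rule elim)
      finally have tail2: "(\<Sum>k. cmod (fps_nth E (k + Suc (2 * n)))) < 1/2" .
      \<comment> \<open>The coefficients up to 2n must carry more than half of the value 1 at
        \<zeta>. Inserting the weight and its reciprocal prepares Cauchy-Schwarz.\<close>
      have "(\<Sum>k\<le>2 * n. cmod (fps_nth E k)) =
          (\<Sum>k\<le>2 * n. \<bar>(real k + 1) powr (\<beta>/2) * cmod (fps_nth E k)\<bar> * \<bar>(real k + 1) powr - (\<beta>/2)\<bar>)"
        by (intro sum.cong refl) (simp add: powr_minus abs_mult)
      also have "\<dots> \<le> L2_set (\<lambda>k. (real k + 1) powr (\<beta>/2) * cmod (fps_nth E k)) {..2 * n} *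
          L2_set (\<lambda>k. (real k + 1) powr - (\<beta>/2)) {..2 * n}"
        by (rule L2_set_mult_ineq)
      also have "L2_set (\<lambda>k. (real k + 1) powr - (\<beta>/2)) {..2 * n} = sqrt (psum \<beta> (2 * n))"
        by (simp add: L2_set_def psum_def power2_eq_square flip: powr_add)
      also have "L2_set (\<lambda>k. (real k + 1) powr (\<beta>/2) * cmod (fps_nth E k)) {..2 * n} * sqrt (psum \<beta> (2 * n)) \<le>
          D * sqrt (psum \<beta> (2 * n))"
        using wl2_boundedD[OF D(2), of "2 * n"] by (intro mult_right_mono) (auto simp: E_def less_imp_le)
      finally show "1/2 \<le> D * sqrt (psum \<beta> (2 * n))"
        using one tail2 by linarith
    qed
  qed
qed

section \<open>The Dirichlet spaces on the bidisk\<close>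

text \<open>The square root of the weight of the space, so that the norm is an \<open>L2_set\<close>
  of weighted moduli.\<close>

definition wt :: "real \<Rightarrow> nat \<Rightarrow> nat \<Rightarrow> real" where
  "wt \<alpha> k l = (real k + 1) powr (\<alpha>/2) * (real l + 1) powr (\<alpha>/2)"

text \<open>Tested on finite index sets, a bound is proved by finite inequalities and yields
  summability by itself.\<close>

definition dbounded :: "real \<Rightarrow> (nat \<Rightarrow> nat \<Rightarrow> complex) \<Rightarrow> real \<Rightarrow> bool" where
  "dbounded \<alpha> a b \<longleftrightarrow> (\<forall>S. finite S \<longrightarrow> L2_set (\<lambda>(k, l). wt \<alpha> k l * cmod (a k l)) S \<le> b)"

definition shift_coeff :: "nat \<Rightarrow> nat \<Rightarrow> (nat \<Rightarrow> nat \<Rightarrow> complex) \<Rightarrow> nat \<Rightarrow> nat \<Rightarrow> complex" where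
  "shift_coeff i j a k l = (if i \<le> k \<and> j \<le> l then a (k - i) (l - j) else 0)"

lemma wt_pos [simp]: "0 < wt \<alpha> k l"
  by (simp add: wt_def)

lemma wt_nonneg [simp]: "0 \<le> wt \<alpha> k l"
  using wt_pos less_imp_le by blast

lemma wt_power2: "(wt \<alpha> k l)\<^sup>2 = (real k + 1) powr \<alpha> * (real l + 1) powr \<alpha>"
proof -
  have "((real m + 1) powr (\<alpha>/2))\<^sup>2 = (real m + 1) powr \<alpha>" for m
    by (simp add: power2_eq_square flip: powr_add)
  then show ?thesis by (simp add: wt_def power_mult_distrib)
qed

lemma dirichlet_weight_eq:
  "(\<lambda>(k, l). (real k + 1) powr \<alpha> * (real l + 1) powr \<alpha> * (cmod (a k l))\<^sup>2) =
   (\<lambda>p. (case p of (k, l) \<Rightarrow> wt \<alpha> k l * cmod (a k l))\<^sup>2)"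
  by (auto simp: fun_eq_iff power_mult_distrib wt_power2)

lemma dbounded_nonneg: "dbounded \<alpha> a b \<Longrightarrow> 0 \<le> b"
  unfolding dbounded_def using L2_set_nonneg order_trans by blast

lemma dbounded_summable:
  assumes "dbounded \<alpha> a b"
  shows "(\<lambda>p. (case p of (k, l) \<Rightarrow> wt \<alpha> k l * cmod (a k l))\<^sup>2) summable_on UNIV"
    and "(\<Sum>\<^sub>\<infinity>p. (case p of (k, l) \<Rightarrow> wt \<alpha> k l * cmod (a k l))\<^sup>2) \<le> b\<^sup>2"
proof -
  let ?g = "\<lambda>p. (case p of (k, l) \<Rightarrow> wt \<alpha> k l * cmod (a k l))\<^sup>2"
  have le: "sum ?g S \<le> b\<^sup>2" if "finite S" for S
  proof -
    have "sqrt (sum ?g S) \<le> b"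
      using assms that by (simp add: dbounded_def L2_set_def)
    then show ?thesis
      using sqrt_le_D by blast
  qed
  show sm: "?g summable_on UNIV"
    by (rule nonneg_bdd_above_summable_on) (auto intro!: bdd_aboveI2[of _ _ "b\<^sup>2"] le)
  show "infsum ?g UNIV \<le> b\<^sup>2"
    by (rule infsum_le_finite_sums[OF sm]) (rule le)
qed

lemma dirichlet_norm_le:
  assumes "has_bidisk_expansion f a" "dbounded \<alpha> a b"
  shows "dirichlet_norm \<alpha> f \<le> b"
  unfolding dirichlet_norm_def bidisk_coeff_eq[OF assms(1)] dirichlet_weight_eq
  using dbounded_summable(2)[OF assms(2)] dbounded_nonneg[OF assms(2)]
  by (intro real_le_lsqrt) (auto intro: infsum_nonneg)

lemma dirichlet_norm_nonneg [simp]: "0 \<le> dirichlet_norm \<alpha> f"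
  unfolding dirichlet_norm_def by (auto intro!: infsum_nonneg)

lemma dirichlet_spaceI:
  "has_bidisk_expansion f a \<Longrightarrow> dbounded \<alpha> a b \<Longrightarrow> f \<in> dirichlet_space \<alpha>"
  unfolding dirichlet_space_def dirichlet_weight_eq using dbounded_summable(1) by blast

lemma dirichlet_space_summable:
  assumes "f \<in> dirichlet_space \<alpha>" "has_bidisk_expansion f a"
  shows "(\<lambda>p. (case p of (k, l) \<Rightarrow> wt \<alpha> k l * cmod (a k l))\<^sup>2) summable_on UNIV"
  using assms has_bidisk_expansion_unique[OF assms(2)]
  unfolding dirichlet_space_def dirichlet_weight_eq by blast

lemma dirichlet_space_dbounded:
  assumes "f \<in> dirichlet_space \<alpha>" "has_bidisk_expansion f a"
  shows "dbounded \<alpha> a (dirichlet_norm \<alpha> f)"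
  unfolding dbounded_def L2_set_def dirichlet_norm_def bidisk_coeff_eq[OF assms(2)] dirichlet_weight_eq
  by (intro allI impI real_sqrt_le_mono finite_sum_le_infsum dirichlet_space_summable[OF assms]) auto

lemma dirichlet_spaceE:
  assumes "f \<in> dirichlet_space \<alpha>"
  obtains a where "has_bidisk_expansion f a" "dbounded \<alpha> a (dirichlet_norm \<alpha> f)"
  using assms dirichlet_space_dbounded unfolding dirichlet_space_def by blast

lemma has_bidisk_expansion_add:
  assumes "has_bidisk_expansion f a" "has_bidisk_expansion g b"
  shows "has_bidisk_expansion (\<lambda>z. f z + g z) (\<lambda>k l. a k l + b k l)"
  unfolding has_bidisk_expansion_def
proof safe
  fix z1 z2 assume z: "(z1, z2) \<in> bidisk"
  then have "((\<lambda>p. (case p of (k, l) \<Rightarrow> a k l * z1 ^ k * z2 ^ l) + (case p of (k, l) \<Rightarrow> b k l * z1 ^ k * z2 ^ l))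
      has_sum f (z1, z2) + g (z1, z2)) UNIV"
    using assms unfolding has_bidisk_expansion_def by (intro has_sum_add) auto
  then show "((\<lambda>(k, l). (a k l + b k l) * z1 ^ k * z2 ^ l) has_sum f (z1, z2) + g (z1, z2)) UNIV"
    by (simp add: case_prod_unfold ring_distribs)
qed

lemma has_bidisk_expansion_cmult:
  assumes "has_bidisk_expansion f a"
  shows "has_bidisk_expansion (\<lambda>z. c * f z) (\<lambda>k l. c * a k l)"
  unfolding has_bidisk_expansion_def
proof safe
  fix z1 z2 assume z: "(z1, z2) \<in> bidisk"
  then have "((\<lambda>p. c * (case p of (k, l) \<Rightarrow> a k l * z1 ^ k * z2 ^ l)) has_sum c * f (z1, z2)) UNIV"
    using assms unfolding has_bidisk_expansion_def by (intro has_sum_cmult_right) auto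
  then show "((\<lambda>(k, l). c * a k l * z1 ^ k * z2 ^ l) has_sum c * f (z1, z2)) UNIV"
    by (simp add: case_prod_unfold mult.assoc)
qed

lemma has_bidisk_expansion_0: "has_bidisk_expansion (\<lambda>_. 0) (\<lambda>_ _. 0)"
  unfolding has_bidisk_expansion_def by (auto intro!: has_sum_0)

lemma has_bidisk_expansion_sum:
  "(\<And>i. i \<in> I \<Longrightarrow> has_bidisk_expansion (f i) (a i)) \<Longrightarrow>
    has_bidisk_expansion (\<lambda>z. \<Sum>i\<in>I. f i z) (\<lambda>k l. \<Sum>i\<in>I. a i k l)"
  by (induction I rule: infinite_finite_induct)
    (auto intro: has_bidisk_expansion_0 has_bidisk_expansion_add)

lemma has_bidisk_expansion_finite:
  assumes "finite S"
  shows "has_bidisk_expansion (\<lambda>z. \<Sum>(k, l)\<in>S. a k l * fst z ^ k * snd z ^ l)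
    (\<lambda>k l. if (k, l) \<in> S then a k l else 0)"
  unfolding has_bidisk_expansion_def
proof safe
  fix z1 z2 :: complex
  show "((\<lambda>(k, l). (if (k, l) \<in> S then a k l else 0) * z1 ^ k * z2 ^ l) has_sum
      (\<Sum>(k, l)\<in>S. a k l * fst (z1, z2) ^ k * snd (z1, z2) ^ l)) UNIV"
    by (rule has_sum_finite_neutralI[OF assms]) (auto intro!: sum.cong)
qed

lemma has_bidisk_expansion_1: "has_bidisk_expansion (\<lambda>_. 1) (\<lambda>k l. if k = 0 \<and> l = 0 then 1 else 0)"
  using has_bidisk_expansion_finite[of "{(0, 0)}" "\<lambda>_ _. 1"]
  by (simp add: if_distrib cong: if_cong)

lemma has_bidisk_expansion_shift:
  assumes "has_bidisk_expansion f a"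
  shows "has_bidisk_expansion (\<lambda>z. fst z ^ i * snd z ^ j * f z) (shift_coeff i j a)"
  unfolding has_bidisk_expansion_def
proof safe
  fix z1 z2 assume z: "(z1, z2) \<in> bidisk"
  let ?h = "\<lambda>(k, l). (k + i, l + j)"
  have inj: "inj ?h" by (auto simp: inj_on_def)
  have "((\<lambda>p. z1 ^ i * z2 ^ j * (case p of (k, l) \<Rightarrow> a k l * z1 ^ k * z2 ^ l)) has_sum
      z1 ^ i * z2 ^ j * f (z1, z2)) UNIV"
    using assms z unfolding has_bidisk_expansion_def by (intro has_sum_cmult_right) auto
  also have "(\<lambda>p. z1 ^ i * z2 ^ j * (case p of (k, l) \<Rightarrow> a k l * z1 ^ k * z2 ^ l)) =
      (\<lambda>(k, l). shift_coeff i j a k l * z1 ^ k * z2 ^ l) \<circ> ?h"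
    by (auto simp: fun_eq_iff shift_coeff_def power_add)
  finally have "((\<lambda>(k, l). shift_coeff i j a k l * z1 ^ k * z2 ^ l) has_sum
      z1 ^ i * z2 ^ j * f (z1, z2)) (range ?h)"
    by (simp only: has_sum_reindex[OF inj])
  also have "?this \<longleftrightarrow> ((\<lambda>(k, l). shift_coeff i j a k l * z1 ^ k * z2 ^ l) has_sum
      z1 ^ i * z2 ^ j * f (z1, z2)) UNIV"
  proof (rule has_sum_cong_neutral)
    fix p assume "p \<in> UNIV - range ?h"
    moreover obtain k l where p: "p = (k, l)" by force
    moreover have "(k, l) = ?h (k - i, l - j)" if "i \<le> k" "j \<le> l"
      using that by simp
    ultimately have "\<not> (i \<le> k \<and> j \<le> l)" by blast
    then show "(case p of (k, l) \<Rightarrow> shift_coeff i j a k l * z1 ^ k * z2 ^ l) = 0"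
      by (auto simp: p shift_coeff_def)
  qed auto
  finally show "((\<lambda>(k, l). shift_coeff i j a k l * z1 ^ k * z2 ^ l) has_sum
      fst (z1, z2) ^ i * snd (z1, z2) ^ j * f (z1, z2)) UNIV"
    by simp
qed

lemma dbounded_add:
  assumes "dbounded \<alpha> a A" "dbounded \<alpha> b B"
  shows "dbounded \<alpha> (\<lambda>k l. a k l + b k l) (A + B)"
  unfolding dbounded_def
proof (intro allI impI)
  fix S :: "(nat \<times> nat) set" assume S: "finite S"
  have "L2_set (\<lambda>(k, l). wt \<alpha> k l * cmod (a k l + b k l)) S \<le>
      L2_set (\<lambda>p. (case p of (k, l) \<Rightarrow> wt \<alpha> k l * cmod (a k l)) + (case p of (k, l) \<Rightarrow> wt \<alpha> k l * cmod (b k l))) S"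
    by (rule L2_set_mono) (auto simp flip: distrib_left intro: mult_left_mono norm_triangle_ineq)
  also have "\<dots> \<le> L2_set (\<lambda>(k, l). wt \<alpha> k l * cmod (a k l)) S + L2_set (\<lambda>(k, l). wt \<alpha> k l * cmod (b k l)) S"
    by (rule L2_set_triangle_ineq)
  also have "\<dots> \<le> A + B"
    using assms S unfolding dbounded_def by (intro add_mono) auto
  finally show "L2_set (\<lambda>(k, l). wt \<alpha> k l * cmod (a k l + b k l)) S \<le> A + B" .
qed

lemma dbounded_cmult:
  assumes "dbounded \<alpha> a A"
  shows "dbounded \<alpha> (\<lambda>k l. c * a k l) (cmod c * A)"
  unfolding dbounded_def
proof (intro allI impI)
  fix S :: "(nat \<times> nat) set" assume S: "finite S"
  have "L2_set (\<lambda>(k, l). wt \<alpha> k l * cmod (c * a k l)) S =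
      L2_set (\<lambda>p. cmod c * (case p of (k, l) \<Rightarrow> wt \<alpha> k l * cmod (a k l))) S"
    by (intro L2_set_cong) (auto simp: norm_mult)
  also have "\<dots> = cmod c * L2_set (\<lambda>(k, l). wt \<alpha> k l * cmod (a k l)) S"
    by (simp add: L2_set_right_distrib)
  also have "\<dots> \<le> cmod c * A"
    using assms S unfolding dbounded_def by (intro mult_left_mono) auto
  finally show "L2_set (\<lambda>(k, l). wt \<alpha> k l * cmod (c * a k l)) S \<le> cmod c * A" .
qed

text \<open>The weight at (k, l) exceeds the weight at (k - i, l - j) by at most a factor depending
  on i and j alone. The exponent \<open>\<bar>\<alpha>\<bar>\<close> covers both signs of
  \<alpha>.\<close>

lemma dbounded_shift:
  assumes "dbounded \<alpha> a A"
  shows "dbounded \<alpha> (shift_coeff i j a) (wt \<bar>\<alpha>\<bar> i j * A)"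
  unfolding dbounded_def
proof (intro allI impI)
  fix S :: "(nat \<times> nat) set" assume S: "finite S"
  define T where "T = {(k, l) \<in> S. i \<le> k \<and> j \<le> l}"
  let ?u = "\<lambda>(k, l). wt \<alpha> k l * cmod (shift_coeff i j a k l)"
  let ?v = "\<lambda>(k, l). wt \<alpha> k l * cmod (a k l)"
  let ?h = "\<lambda>(k, l). (k - i, l - j)"
  have T: "finite T" using S by (rule rev_finite_subset) (auto simp: T_def)
  have wt_le: "wt \<alpha> k l \<le> wt \<bar>\<alpha>\<bar> i j * wt \<alpha> (k - i) (l - j)" if "i \<le> k" "j \<le> l" for k l
  proof -
    have "wt \<alpha> k l \<le> ((real i + 1) powr \<bar>\<alpha>/2\<bar> * (real (k - i) + 1) powr (\<alpha>/2)) *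
        ((real j + 1) powr \<bar>\<alpha>/2\<bar> * (real (l - j) + 1) powr (\<alpha>/2))"
      unfolding wt_def using powr_add_le[of "k - i" i "\<alpha>/2"] powr_add_le[of "l - j" j "\<alpha>/2"] that
      by (intro mult_mono) auto
    also have "\<dots> = wt \<bar>\<alpha>\<bar> i j * wt \<alpha> (k - i) (l - j)"
      by (simp add: wt_def mult_ac)
    finally show ?thesis .
  qed
  have "(\<Sum>p\<in>S. (?u p)\<^sup>2) = (\<Sum>p\<in>T. (?u p)\<^sup>2)"
    using S by (intro sum.mono_neutral_right) (auto simp: T_def shift_coeff_def split: if_splits)
  then have "L2_set ?u S = L2_set ?u T"
    by (simp add: L2_set_def)
  also have "\<dots> \<le> L2_set (\<lambda>p. wt \<bar>\<alpha>\<bar> i j * ?v (?h p)) T"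
  proof (rule L2_set_mono)
    fix p assume "p \<in> T"
    then obtain k l where p: "p = (k, l)" "i \<le> k" "j \<le> l" by (auto simp: T_def)
    have "wt \<alpha> k l * cmod (a (k - i) (l - j)) \<le> wt \<bar>\<alpha>\<bar> i j * wt \<alpha> (k - i) (l - j) * cmod (a (k - i) (l - j))"
      using wt_le[OF p(2,3)] by (intro mult_right_mono) auto
    then show "?u p \<le> wt \<bar>\<alpha>\<bar> i j * ?v (?h p)"
      using p by (simp add: shift_coeff_def mult.assoc)
  qed auto
  also have "\<dots> = wt \<bar>\<alpha>\<bar> i j * L2_set (\<lambda>p. ?v (?h p)) T"
    by (simp add: L2_set_right_distrib)
  also have "L2_set (\<lambda>p. ?v (?h p)) T = L2_set ?v (?h ` T)"
  proof -
    have "inj_on ?h T" by (auto simp: inj_on_def T_def)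
    then show ?thesis by (simp add: L2_set_def sum.reindex)
  qed
  also have "wt \<bar>\<alpha>\<bar> i j * L2_set ?v (?h ` T) \<le> wt \<bar>\<alpha>\<bar> i j * A"
    using assms T unfolding dbounded_def by (intro mult_left_mono) auto
  finally show "L2_set ?u S \<le> wt \<bar>\<alpha>\<bar> i j * A" .
qed

lemma dirichlet_add:
  assumes "f \<in> dirichlet_space \<alpha>" "g \<in> dirichlet_space \<alpha>"
  shows "(\<lambda>z. f z + g z) \<in> dirichlet_space \<alpha>"
    and "dirichlet_norm \<alpha> (\<lambda>z. f z + g z) \<le> dirichlet_norm \<alpha> f + dirichlet_norm \<alpha> g"
proof -
  obtain a where a: "has_bidisk_expansion f a" "dbounded \<alpha> a (dirichlet_norm \<alpha> f)"
    using dirichlet_spaceE[OF assms(1)] .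
  obtain b where b: "has_bidisk_expansion g b" "dbounded \<alpha> b (dirichlet_norm \<alpha> g)"
    using dirichlet_spaceE[OF assms(2)] .
  note e = has_bidisk_expansion_add[OF a(1) b(1)] dbounded_add[OF a(2) b(2)]
  show "(\<lambda>z. f z + g z) \<in> dirichlet_space \<alpha>"
    using e by (rule dirichlet_spaceI)
  show "dirichlet_norm \<alpha> (\<lambda>z. f z + g z) \<le> dirichlet_norm \<alpha> f + dirichlet_norm \<alpha> g"
    using e by (rule dirichlet_norm_le)
qed

lemma dirichlet_cmult:
  assumes "f \<in> dirichlet_space \<alpha>"
  shows "(\<lambda>z. c * f z) \<in> dirichlet_space \<alpha>"
    and "dirichlet_norm \<alpha> (\<lambda>z. c * f z) \<le> cmod c * dirichlet_norm \<alpha> f"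
proof -
  obtain a where a: "has_bidisk_expansion f a" "dbounded \<alpha> a (dirichlet_norm \<alpha> f)"
    using dirichlet_spaceE[OF assms(1)] .
  note e = has_bidisk_expansion_cmult[OF a(1)] dbounded_cmult[OF a(2)]
  show "(\<lambda>z. c * f z) \<in> dirichlet_space \<alpha>"
    using e by (rule dirichlet_spaceI)
  show "dirichlet_norm \<alpha> (\<lambda>z. c * f z) \<le> cmod c * dirichlet_norm \<alpha> f"
    using e by (rule dirichlet_norm_le)
qed

lemma dirichlet_shift:
  assumes "f \<in> dirichlet_space \<alpha>"
  shows "(\<lambda>z. fst z ^ i * snd z ^ j * f z) \<in> dirichlet_space \<alpha>"
    and "dirichlet_norm \<alpha> (\<lambda>z. fst z ^ i * snd z ^ j * f z) \<le> wt \<bar>\<alpha>\<bar> i j * dirichlet_norm \<alpha> f"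
proof -
  obtain a where a: "has_bidisk_expansion f a" "dbounded \<alpha> a (dirichlet_norm \<alpha> f)"
    using dirichlet_spaceE[OF assms(1)] .
  note e = has_bidisk_expansion_shift[OF a(1)] dbounded_shift[OF a(2)]
  show "(\<lambda>z. fst z ^ i * snd z ^ j * f z) \<in> dirichlet_space \<alpha>"
    using e by (rule dirichlet_spaceI)
  show "dirichlet_norm \<alpha> (\<lambda>z. fst z ^ i * snd z ^ j * f z) \<le> wt \<bar>\<alpha>\<bar> i j * dirichlet_norm \<alpha> f"
    using e by (rule dirichlet_norm_le)
qed

lemma dirichlet_finite:
  assumes "finite S"
  shows "(\<lambda>z. \<Sum>(k, l)\<in>S. a k l * fst z ^ k * snd z ^ l) \<in> dirichlet_space \<alpha>"
proof (rule dirichlet_spaceI[OF has_bidisk_expansion_finite[OF assms]])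
  let ?u = "\<lambda>(k, l). wt \<alpha> k l * cmod (if (k, l) \<in> S then a k l else 0)"
  show "dbounded \<alpha> (\<lambda>k l. if (k, l) \<in> S then a k l else 0) (\<Sum>p\<in>S. ?u p)"
    unfolding dbounded_def
  proof (intro allI impI)
    fix T :: "(nat \<times> nat) set" assume T: "finite T"
    have "L2_set ?u T \<le> sum ?u T"
      by (rule L2_set_le_sum) auto
    also have "\<dots> = sum ?u (T \<inter> S)"
      using T by (intro sum.mono_neutral_right) (auto split: if_splits)
    also have "\<dots> \<le> sum ?u S"
      using assms by (intro sum_mono2) auto
    finally show "L2_set ?u T \<le> sum ?u S" .
  qed
qed

lemma dirichlet_1: "(\<lambda>_. 1) \<in> dirichlet_space \<alpha>"
  using dirichlet_finite[of "{(0, 0)}" "\<lambda>_ _. 1" \<alpha>] by simp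

lemma dirichlet_diff:
  assumes "f \<in> dirichlet_space \<alpha>" "g \<in> dirichlet_space \<alpha>"
  shows "(\<lambda>z. f z - g z) \<in> dirichlet_space \<alpha>"
  using dirichlet_add(1)[OF assms(1) dirichlet_cmult(1)[OF assms(2), of "-1"]] by simp

section \<open>Polynomials as multipliers, density and cyclicity\<close>

lemma poly_spaceE:
  assumes "p \<in> poly_space n"
  obtains c where "p = (\<lambda>z. \<Sum>k\<le>n. \<Sum>l\<le>n. c k l * fst z ^ k * snd z ^ l)"
  using assms unfolding poly_space_def by (auto simp: case_prod_unfold)

lemma poly_spaceI: "(\<lambda>z. \<Sum>k\<le>n. \<Sum>l\<le>n. c k l * fst z ^ k * snd z ^ l) \<in> poly_space n"
  unfolding poly_space_def by (auto simp: case_prod_unfold)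

lemma poly_space_monomial:
  assumes "u \<le> n" "v \<le> n"
  shows "(\<lambda>z. c * fst z ^ u * snd z ^ v) \<in> poly_space n"
proof -
  have "(\<Sum>k\<le>n. \<Sum>l\<le>n. (if k = u \<and> l = v then c else 0) * fst z ^ k * snd z ^ l) = c * fst z ^ u * snd z ^ v" for z
  proof -
    have "(\<Sum>l\<le>n. (if k = u \<and> l = v then c else 0) * fst z ^ k * snd z ^ l) =
        (\<Sum>l\<le>n. if l = v then (if k = u then c * fst z ^ u * snd z ^ v else 0) else 0)" for k
      by (intro sum.cong) auto
    then show ?thesis using assms by simp
  qed
  then show ?thesis
    using poly_spaceI[of "\<lambda>k l. if k = u \<and> l = v then c else 0" n] by (simp only:)
qed

lemma poly_space_add:
  assumes "p \<in> poly_space n" "q \<in> poly_space n"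
  shows "(\<lambda>z. p z + q z) \<in> poly_space n"
proof -
  obtain c where p: "p = (\<lambda>z. \<Sum>k\<le>n. \<Sum>l\<le>n. c k l * fst z ^ k * snd z ^ l)"
    using poly_spaceE[OF assms(1)] .
  obtain d where q: "q = (\<lambda>z. \<Sum>k\<le>n. \<Sum>l\<le>n. d k l * fst z ^ k * snd z ^ l)"
    using poly_spaceE[OF assms(2)] .
  have "(\<lambda>z. p z + q z) = (\<lambda>z. \<Sum>k\<le>n. \<Sum>l\<le>n. (c k l + d k l) * fst z ^ k * snd z ^ l)"
    by (simp add: p q sum.distrib ring_distribs)
  then show ?thesis using poly_spaceI by simp
qed

lemma poly_space_0: "(\<lambda>_. 0) \<in> poly_space n"
  using poly_spaceI[of "\<lambda>_ _. 0" n] by simp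

lemma poly_space_sum:
  "(\<And>i. i \<in> I \<Longrightarrow> p i \<in> poly_space n) \<Longrightarrow> (\<lambda>z. \<Sum>i\<in>I. p i z) \<in> poly_space n"
  by (induction I rule: infinite_finite_induct) (auto intro: poly_space_0 poly_space_add)

lemma poly_space_mult:
  assumes "p \<in> poly_space m" "q \<in> poly_space n"
  shows "(\<lambda>z. p z * q z) \<in> poly_space (m + n)"
proof -
  obtain c where p: "p = (\<lambda>z. \<Sum>k\<le>m. \<Sum>l\<le>m. c k l * fst z ^ k * snd z ^ l)"
    using poly_spaceE[OF assms(1)] .
  obtain d where q: "q = (\<lambda>z. \<Sum>k\<le>n. \<Sum>l\<le>n. d k l * fst z ^ k * snd z ^ l)"
    using poly_spaceE[OF assms(2)] .
  have "(\<lambda>z. p z * q z) = (\<lambda>z. \<Sum>k\<le>m. \<Sum>l\<le>m. \<Sum>i\<le>n. \<Sum>j\<le>n. (c k l * d i j) * fst z ^ (k + i) * snd z ^ (l + j))"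
    unfolding p q sum_distrib_right unfolding sum_distrib_left
    by (intro ext sum.cong refl) (simp add: power_add mult_ac)
  also have "\<dots> \<in> poly_space (m + n)"
    by (intro poly_space_sum poly_space_monomial) auto
  finally show ?thesis .
qed

lemma dirichlet_0: "(\<lambda>_. 0) \<in> dirichlet_space \<alpha>" "dirichlet_norm \<alpha> (\<lambda>_. 0) = 0"
proof -
  have "dbounded \<alpha> (\<lambda>_ _. 0) 0"
    by (auto simp: dbounded_def L2_set_def case_prod_unfold)
  then show "(\<lambda>_. 0) \<in> dirichlet_space \<alpha>" "dirichlet_norm \<alpha> (\<lambda>_. 0) = 0"
    using dirichlet_spaceI[OF has_bidisk_expansion_0] dirichlet_norm_le[OF has_bidisk_expansion_0]
      dirichlet_norm_nonneg by (blast, metis order_antisym)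
qed

lemma dirichlet_sum:
  "finite I \<Longrightarrow> (\<And>i. i \<in> I \<Longrightarrow> f i \<in> dirichlet_space \<alpha>) \<Longrightarrow>
    (\<lambda>z. \<Sum>i\<in>I. f i z) \<in> dirichlet_space \<alpha> \<and>
    dirichlet_norm \<alpha> (\<lambda>z. \<Sum>i\<in>I. f i z) \<le> (\<Sum>i\<in>I. dirichlet_norm \<alpha> (f i))"
proof (induction I rule: finite_induct)
  case (insert i I)
  then show ?case
    using dirichlet_add[of "f i" \<alpha> "\<lambda>z. \<Sum>i\<in>I. f i z"] by simp
qed (simp add: dirichlet_0)

lemma poly_multiplier:
  assumes "p \<in> poly_space n"
  obtains K where "K \<ge> 0" "\<And>f. f \<in> dirichlet_space \<alpha> \<Longrightarrow>
    (\<lambda>z. p z * f z) \<in> dirichlet_space \<alpha> \<and>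
    dirichlet_norm \<alpha> (\<lambda>z. p z * f z) \<le> K * dirichlet_norm \<alpha> f"
proof -
  obtain c where p: "p = (\<lambda>z. \<Sum>k\<le>n. \<Sum>l\<le>n. c k l * fst z ^ k * snd z ^ l)"
    using poly_spaceE[OF assms(1)] .
  define I where "I = {..n} \<times> {..n}"
  define K where "K = (\<Sum>(k, l)\<in>I. cmod (c k l) * wt \<bar>\<alpha>\<bar> k l)"
  have pI: "p z = (\<Sum>(k, l)\<in>I. c k l * fst z ^ k * snd z ^ l)" for z
    by (simp add: p I_def sum.cartesian_product)
  have "(\<lambda>z. p z * f z) \<in> dirichlet_space \<alpha> \<and>
    dirichlet_norm \<alpha> (\<lambda>z. p z * f z) \<le> K * dirichlet_norm \<alpha> f" if f: "f \<in> dirichlet_space \<alpha>" for f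
  proof -
    let ?g = "\<lambda>(k, l) z. c k l * (fst z ^ k * snd z ^ l * f z)"
    have eq: "(\<lambda>z. p z * f z) = (\<lambda>z. \<Sum>i\<in>I. ?g i z)"
      unfolding pI sum_distrib_right by (simp add: case_prod_unfold mult_ac)
    have g: "?g i \<in> dirichlet_space \<alpha>" for i
      using dirichlet_cmult(1)[OF dirichlet_shift(1)[OF f]] by (simp add: case_prod_unfold)
    have "dirichlet_norm \<alpha> (?g i) \<le> (case i of (k, l) \<Rightarrow> cmod (c k l) * wt \<bar>\<alpha>\<bar> k l) * dirichlet_norm \<alpha> f" for i
    proof -
      obtain k l where i: "i = (k, l)" by force
      have "dirichlet_norm \<alpha> (?g i) \<le> cmod (c k l) * dirichlet_norm \<alpha> (\<lambda>z. fst z ^ k * snd z ^ l * f z)"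
        using dirichlet_cmult(2)[OF dirichlet_shift(1)[OF f]] by (simp add: i)
      also have "\<dots> \<le> cmod (c k l) * (wt \<bar>\<alpha>\<bar> k l * dirichlet_norm \<alpha> f)"
        by (intro mult_left_mono dirichlet_shift(2) f) auto
      finally show ?thesis by (simp add: i mult.assoc)
    qed
    then have "(\<Sum>i\<in>I. dirichlet_norm \<alpha> (?g i)) \<le> K * dirichlet_norm \<alpha> f"
      unfolding K_def sum_distrib_right by (intro sum_mono)
    moreover have "(\<lambda>z. \<Sum>i\<in>I. ?g i z) \<in> dirichlet_space \<alpha> \<and>
        dirichlet_norm \<alpha> (\<lambda>z. \<Sum>i\<in>I. ?g i z) \<le> (\<Sum>i\<in>I. dirichlet_norm \<alpha> (?g i))"
      using g by (intro dirichlet_sum) (auto simp: I_def)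
    ultimately show ?thesis unfolding eq by linarith
  qed
  moreover have "K \<ge> 0"
    unfolding K_def by (intro sum_nonneg) (auto simp: case_prod_unfold)
  ultimately show ?thesis using that by blast
qed

lemma polynomials_dense:
  assumes g: "g \<in> dirichlet_space \<alpha>" and \<epsilon>: "\<epsilon> > 0"
  obtains n q where "q \<in> poly_space n" "dirichlet_norm \<alpha> (\<lambda>z. q z - g z) < \<epsilon>"
proof -
  obtain a where a: "has_bidisk_expansion g a"
    using dirichlet_spaceE[OF g] by blast
  let ?w = "\<lambda>p. (case p of (k, l) \<Rightarrow> wt \<alpha> k l * cmod (a k l))\<^sup>2"
  have sm: "?w summable_on UNIV"
    by (rule dirichlet_space_summable[OF g a])
  \<comment> \<open>The infinite sum is the squared norm, hence the squared tolerance.\<close>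
  obtain S where S: "finite S" "dist (sum ?w S) (infsum ?w UNIV) \<le> (\<epsilon>/2)\<^sup>2"
    using infsum_finite_approximation[OF sm, of "(\<epsilon>/2)\<^sup>2"] \<epsilon> by auto
  define q where "q = (\<lambda>z. \<Sum>(k, l)\<in>S. a k l * fst z ^ k * snd z ^ l)"
  obtain n where n: "\<And>k l. (k, l) \<in> S \<Longrightarrow> k \<le> n \<and> l \<le> n"
  proof
    fix k l assume kl: "(k, l) \<in> S"
    have "max k l \<le> Max ((\<lambda>(k, l). max k l) ` S)"
      using S(1) kl by (intro Max_ge) force+
    then show "k \<le> Max ((\<lambda>(k, l). max k l) ` S) \<and> l \<le> Max ((\<lambda>(k, l). max k l) ` S)"
      by simp
  qed
  have "q \<in> poly_space n"
    unfolding q_def case_prod_unfold using n by (intro poly_space_sum poly_space_monomial) auto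
  moreover have "dirichlet_norm \<alpha> (\<lambda>z. q z - g z) \<le> \<epsilon>/2"
  proof (rule dirichlet_norm_le)
    show "has_bidisk_expansion (\<lambda>z. q z - g z) (\<lambda>k l. (if (k, l) \<in> S then a k l else 0) + (-1) * a k l)"
      using has_bidisk_expansion_add[OF has_bidisk_expansion_finite[OF S(1)] has_bidisk_expansion_cmult[OF a, of "-1"], of a]
      by (simp add: q_def)
    show "dbounded \<alpha> (\<lambda>k l. (if (k, l) \<in> S then a k l else 0) + (-1) * a k l) (\<epsilon>/2)"
      unfolding dbounded_def
    proof (intro allI impI)
      fix T :: "(nat \<times> nat) set" assume T: "finite T"
      have "(\<Sum>p\<in>T. (case p of (k, l) \<Rightarrow> wt \<alpha> k l * cmod ((if (k, l) \<in> S then a k l else 0) + (-1) * a k l))\<^sup>2) =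
          sum ?w (T - S)"
        using T by (intro sum.mono_neutral_cong_right) auto
      also have "\<dots> = sum ?w (S \<union> (T - S)) - sum ?w S"
        using sum.union_disjoint[of S "T - S" ?w] S T by auto
      also have "\<dots> \<le> infsum ?w UNIV - sum ?w S"
        using S T by (intro diff_right_mono finite_sum_le_infsum[OF sm]) auto
      also have "\<dots> \<le> (\<epsilon>/2)\<^sup>2"
        using S(2) by (simp add: dist_real_def)
      finally show "L2_set (\<lambda>(k, l). wt \<alpha> k l * cmod ((if (k, l) \<in> S then a k l else 0) + (-1) * a k l)) T \<le> \<epsilon>/2"
        unfolding L2_set_def using \<epsilon> by (intro real_le_lsqrt) (auto intro: sum_nonneg)
    qed
  qed
  ultimately show ?thesis using that \<epsilon> by fastforce
qed

lemma shift_span_iff: "h \<in> shift_span f \<longleftrightarrow> (\<exists>n. \<exists>p\<in>poly_space n. h = (\<lambda>z. p z * f z))"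
proof
  assume "h \<in> shift_span f"
  then obtain n c where h: "h = (\<lambda>(z1, z2). \<Sum>k\<le>n. \<Sum>l\<le>n. c k l * (z1 ^ k * z2 ^ l * f (z1, z2)))"
    unfolding shift_span_def by blast
  have "h = (\<lambda>z. (\<Sum>k\<le>n. \<Sum>l\<le>n. c k l * fst z ^ k * snd z ^ l) * f z)"
    unfolding h sum_distrib_right by (auto simp: mult_ac)
  then show "\<exists>n. \<exists>p\<in>poly_space n. h = (\<lambda>z. p z * f z)"
    by (intro exI[of _ n] bexI[OF _ poly_spaceI[of c n]])
next
  assume "\<exists>n. \<exists>p\<in>poly_space n. h = (\<lambda>z. p z * f z)"
  then obtain n p where p: "p \<in> poly_space n" "h = (\<lambda>z. p z * f z)" by blast
  obtain c where c: "p = (\<lambda>z. \<Sum>k\<le>n. \<Sum>l\<le>n. c k l * fst z ^ k * snd z ^ l)"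
    using poly_spaceE[OF p(1)] .
  have "h = (\<lambda>(z1, z2). \<Sum>k\<le>n. \<Sum>l\<le>n. c k l * (z1 ^ k * z2 ^ l * f (z1, z2)))"
    unfolding p(2) c sum_distrib_right by (auto simp: mult_ac)
  then show "h \<in> shift_span f"
    unfolding shift_span_def by blast
qed

text \<open>Approximating 1 is enough: if a polynomial q is close to g, then q p f - g = q (p f - 1)
  + (q - g), and multiplication by q is bounded.\<close>

lemma cyclicI:
  assumes f: "f \<in> dirichlet_space \<alpha>"
    and approx: "\<And>\<epsilon>. \<epsilon> > 0 \<Longrightarrow> \<exists>n. \<exists>p\<in>poly_space n. dirichlet_norm \<alpha> (\<lambda>z. p z * f z - 1) < \<epsilon>"
  shows "cyclic \<alpha> f"
proof -
  have "g \<in> closed_shift_span \<alpha> f" if g: "g \<in> dirichlet_space \<alpha>" for g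
    unfolding closed_shift_span_def
  proof (intro CollectI conjI g allI impI)
    fix \<epsilon> :: real assume \<epsilon>: "\<epsilon> > 0"
    obtain m q where q: "q \<in> poly_space m" "dirichlet_norm \<alpha> (\<lambda>z. q z - g z) < \<epsilon>/2"
      using polynomials_dense[OF g half_gt_zero[OF \<epsilon>]] by blast
    obtain K where K: "K \<ge> 0" "\<And>f. f \<in> dirichlet_space \<alpha> \<Longrightarrow> (\<lambda>z. q z * f z) \<in> dirichlet_space \<alpha> \<and>
        dirichlet_norm \<alpha> (\<lambda>z. q z * f z) \<le> K * dirichlet_norm \<alpha> f"
      using poly_multiplier[OF q(1)] by blast
    \<comment> \<open>p is chosen after q, so the tolerance may depend on the multiplier bound K of
      q; K + 1 avoids division by 0.\<close>
    obtain n p where p: "p \<in> poly_space n" "dirichlet_norm \<alpha> (\<lambda>z. p z * f z - 1) < \<epsilon> / (2 * (K + 1))"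
      using approx[of "\<epsilon> / (2 * (K + 1))"] \<epsilon> K(1) by auto
    have "(\<lambda>z. p z * f z) \<in> dirichlet_space \<alpha>"
      using poly_multiplier[OF p(1), of \<alpha>] f by metis
    then have pf: "(\<lambda>z. p z * f z - 1) \<in> dirichlet_space \<alpha>"
      using dirichlet_diff[OF _ dirichlet_1] by simp
    have "(\<lambda>z. q z * 1) \<in> dirichlet_space \<alpha>"
      using K(2)[OF dirichlet_1] by simp
    then have qg: "(\<lambda>z. q z - g z) \<in> dirichlet_space \<alpha>"
      using dirichlet_diff[OF _ g] by simp
    have "dirichlet_norm \<alpha> (\<lambda>z. q z * (p z * f z - 1)) \<le> K * dirichlet_norm \<alpha> (\<lambda>z. p z * f z - 1)"
      using K(2)[OF pf] by simp
    also have "\<dots> \<le> (K + 1) * dirichlet_norm \<alpha> (\<lambda>z. p z * f z - 1)"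
      by (intro mult_right_mono) auto
    also have "\<dots> < (K + 1) * (\<epsilon> / (2 * (K + 1)))"
      using K(1) by (intro mult_strict_left_mono p(2)) auto
    also have "\<dots> = \<epsilon>/2" using K(1) by (simp add: field_simps)
    finally have 1: "dirichlet_norm \<alpha> (\<lambda>z. q z * (p z * f z - 1)) < \<epsilon>/2" .
    have "dirichlet_norm \<alpha> (\<lambda>z. q z * (p z * f z - 1) + (q z - g z)) < \<epsilon>"
      using dirichlet_add(2)[OF conjunct1[OF K(2)[OF pf]] qg] 1 q(2) by linarith
    then have "dirichlet_norm \<alpha> (\<lambda>z. (q z * p z) * f z - g z) < \<epsilon>"
      by (simp add: algebra_simps)
    moreover have "(\<lambda>z. (q z * p z) * f z) \<in> shift_span f"
      unfolding shift_span_iff by (intro exI[of _ "m + n"] bexI[OF _ poly_space_mult[OF q(1) p(1)]] refl)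
    ultimately show "\<exists>h\<in>shift_span f. dirichlet_norm \<alpha> (\<lambda>z. h z - g z) < \<epsilon>"
      by (rule bexI)
  qed
  then have "closed_shift_span \<alpha> f = dirichlet_space \<alpha>"
    unfolding closed_shift_span_def by blast
  with f show ?thesis by (simp add: cyclic_def)
qed

section \<open>Functions of a monomial\<close>

text \<open>The position on the diagonal is read off from the first index, which works for N = 0
  too.\<close>

definition diag_coeff :: "nat \<Rightarrow> nat \<Rightarrow> (nat \<Rightarrow> complex) \<Rightarrow> nat \<Rightarrow> nat \<Rightarrow> complex" where
  "diag_coeff M N e k l = (if M dvd k \<and> l = N * (k div M) then e (k div M) else 0)"

text \<open>
  With \<open>N = 0\<close> and \<open>M = 1\<close> the functions on the diagonal \<open>(M k, N k)\<close> are those that do not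
  depend on the second variable, so both parts of the theorem are instances of one statement
  whose exponent is \<open>diag_exp\<close>.
\<close>

definition diag_exp :: "real \<Rightarrow> nat \<Rightarrow> real" where
  "diag_exp \<alpha> N = (if N = 0 then \<alpha> else 2 * \<alpha>)"

lemma diag_coeff_diag [simp]: "M \<ge> 1 \<Longrightarrow> diag_coeff M N e (M * k) (N * k) = e k"
  by (simp add: diag_coeff_def)

lemma diag_coeff_off:
  assumes "(k, l) \<notin> range (\<lambda>j. (M * j, N * j))"
  shows "diag_coeff M N e k l = 0"
proof -
  have "\<not> (M dvd k \<and> l = N * (k div M))"
  proof
    assume "M dvd k \<and> l = N * (k div M)"
    then have "(k, l) = (M * (k div M), N * (k div M))" by simp
    then show False using assms by blast
  qed
  then show ?thesis by (auto simp: diag_coeff_def)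
qed

lemma inj_diag: "M \<ge> 1 \<Longrightarrow> inj (\<lambda>j::nat. (M * j, N * j))"
  by (auto simp: inj_on_def)

lemma monomial_in_disk:
  assumes "(z1, z2) \<in> bidisk" "M \<ge> 1"
  shows "cmod (z1 ^ M * z2 ^ N) < 1"
proof -
  have z: "cmod z1 < 1" "cmod z2 < 1"
    using assms by (auto simp: bidisk_def)
  have "cmod (z1 ^ M * z2 ^ N) = cmod z1 ^ M * cmod z2 ^ N"
    by (simp add: norm_mult norm_power)
  also have "\<dots> \<le> cmod z1 ^ M * 1"
    using z by (intro mult_left_mono power_le_one) auto
  also have "\<dots> \<le> cmod z1 ^ 1 * 1"
    using z assms by (intro mult_right_mono power_decreasing) auto
  finally show ?thesis using z by simp
qed

lemma has_bidisk_expansion_diag: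
  assumes M: "M \<ge> 1" and E: "fps_conv_radius E \<ge> 1"
    and g: "\<And>z1 z2. (z1, z2) \<in> bidisk \<Longrightarrow> g (z1, z2) = eval_fps E (z1 ^ M * z2 ^ N)"
  shows "has_bidisk_expansion g (diag_coeff M N (fps_nth E))"
  unfolding has_bidisk_expansion_def
proof safe
  fix z1 z2 assume z: "(z1, z2) \<in> bidisk"
  let ?w = "z1 ^ M * z2 ^ N"
  let ?h = "\<lambda>j. (M * j, N * j)"
  let ?u = "\<lambda>(k, l). diag_coeff M N (fps_nth E) k l * z1 ^ k * z2 ^ l"
  have "ereal (cmod ?w) < 1"
    using monomial_in_disk[OF z M] by (simp add: one_ereal_def)
  then have w: "ereal (cmod ?w) < fps_conv_radius E"
    using E by (rule less_le_trans)
  have "((\<lambda>k. fps_nth E k * ?w ^ k) has_sum eval_fps E ?w) UNIV"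
    by (intro norm_summable_imp_has_sum norm_summable_fps sums_eval_fps w)
  also have "(\<lambda>k. fps_nth E k * ?w ^ k) = ?u \<circ> ?h"
    using M by (simp add: fun_eq_iff power_mult power_mult_distrib)
  finally have "(?u has_sum g (z1, z2)) (range ?h)"
    unfolding g[OF z] by (simp only: has_sum_reindex[OF inj_diag[OF M]])
  also have "?this \<longleftrightarrow> (?u has_sum g (z1, z2)) UNIV"
    by (rule has_sum_cong_neutral) (use diag_coeff_off in auto)
  finally show "(?u has_sum g (z1, z2)) UNIV" .
qed

text \<open>The source of the two rates: for N \<ge> 1 both factors of the weight are comparable to
  (j+1)^(\<alpha>/2), while for N = 0 the second one is constant.\<close>

lemma wt_diag:
  assumes "M \<ge> 1"
  obtains K where "K \<ge> 1" "\<And>j. wt \<alpha> (M * j) (N * j) \<le> K * (real j + 1) powr (diag_exp \<alpha> N / 2)"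
    "\<And>j. (real j + 1) powr (diag_exp \<alpha> N / 2) \<le> K * wt \<alpha> (M * j) (N * j)"
proof -
  define t where "t = \<alpha>/2"
  define K1 where "K1 = real M powr \<bar>t\<bar>"
  define K2 where "K2 = (if N = 0 then 1 else real N powr \<bar>t\<bar>)"
  define y where "y j = (if N = 0 then 1 else (real j + 1) powr t)" for j
  have le: "(real (m * j) + 1) powr t \<le> real m powr \<bar>t\<bar> * (real j + 1) powr t"
     "(real j + 1) powr t \<le> real m powr \<bar>t\<bar> * (real (m * j) + 1) powr t" if "m \<ge> 1" for m j
  proof -
    have "real j \<le> real m * real j"
      using that by (simp add: mult_le_cancel_right1)
    then show "(real (m * j) + 1) powr t \<le> real m powr \<bar>t\<bar> * (real j + 1) powr t"
     "(real j + 1) powr t \<le> real m powr \<bar>t\<bar> * (real (m * j) + 1) powr t"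
      using that powr_comparable[of "real j + 1" "real (m * j) + 1" "real m" t] by (auto simp: algebra_simps)
  qed
  have K: "K1 \<ge> 1" "K2 \<ge> 1"
    using assms by (auto simp: K1_def K2_def ge_one_powr_ge_zero)
  have yN: "(real (N * j) + 1) powr t \<le> K2 * y j" "y j \<le> K2 * (real (N * j) + 1) powr t" for j
    using le[of N j] by (auto simp: K2_def y_def)
  have eq: "(real j + 1) powr (diag_exp \<alpha> N / 2) = (real j + 1) powr t * y j" for j
    by (auto simp: y_def diag_exp_def t_def simp flip: powr_add)
  have "1 * 1 \<le> K1 * K2"
    using K by (intro mult_mono) auto
  moreover have "wt \<alpha> (M * j) (N * j) \<le> K1 * K2 * (real j + 1) powr (diag_exp \<alpha> N / 2)" for j
  proof -
    have "wt \<alpha> (M * j) (N * j) \<le> (K1 * (real j + 1) powr t) * (K2 * y j)"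
      unfolding wt_def t_def[symmetric] K1_def using le(1)[OF assms] yN(1) by (intro mult_mono) auto
    then show ?thesis by (simp add: eq mult_ac)
  qed
  moreover have "(real j + 1) powr (diag_exp \<alpha> N / 2) \<le> K1 * K2 * wt \<alpha> (M * j) (N * j)" for j
  proof -
    have "(real j + 1) powr (diag_exp \<alpha> N / 2) \<le> (K1 * (real (M * j) + 1) powr t) * (K2 * (real (N * j) + 1) powr t)"
      unfolding eq K1_def using le(2)[OF assms] yN(2) by (intro mult_mono) (auto simp: y_def)
    then show ?thesis by (simp add: wt_def t_def mult_ac)
  qed
  ultimately show ?thesis using that[of "K1 * K2"] by simp
qed

lemma dbounded_diag:
  assumes M: "M \<ge> 1" and E: "wl2_bounded \<gamma> E b" and K: "K \<ge> 0"
    and wt: "\<And>j. wt \<alpha> (M * j) (N * j) \<le> K * (real j + 1) powr \<gamma>"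
  shows "dbounded \<alpha> (diag_coeff M N (fps_nth E)) (K * b)"
  unfolding dbounded_def
proof (intro allI impI)
  fix S :: "(nat \<times> nat) set" assume S: "finite S"
  let ?h = "\<lambda>j. (M * j, N * j)"
  let ?u = "\<lambda>(k, l). wt \<alpha> k l * cmod (diag_coeff M N (fps_nth E) k l)"
  define T where "T = ?h -` S"
  have T: "finite T"
    unfolding T_def using S inj_diag[OF M] by (rule finite_vimageI)
  then obtain m where m: "T \<subseteq> {..m}"
    using finite_nat_iff_bounded_le by blast
  have "(\<Sum>p\<in>S. (?u p)\<^sup>2) = (\<Sum>p\<in>?h ` T. (?u p)\<^sup>2)"
    using S diag_coeff_off by (intro sum.mono_neutral_right) (fastforce simp: T_def)+
  also have "\<dots> = (\<Sum>j\<in>T. (?u (?h j))\<^sup>2)"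
    using inj_diag[OF M] by (subst sum.reindex) (auto intro: inj_on_subset)
  finally have "L2_set ?u S = L2_set (\<lambda>j. ?u (?h j)) T"
    by (simp add: L2_set_def)
  also have "\<dots> \<le> L2_set (\<lambda>j. K * ((real j + 1) powr \<gamma> * cmod (fps_nth E j))) T"
  proof (rule L2_set_mono)
    fix j
    show "?u (?h j) \<le> K * ((real j + 1) powr \<gamma> * cmod (fps_nth E j))"
      using M mult_right_mono[OF wt norm_ge_zero] by (simp add: mult.assoc)
  qed auto
  also have "\<dots> = K * L2_set (\<lambda>j. (real j + 1) powr \<gamma> * cmod (fps_nth E j)) T"
    using K by (simp add: L2_set_right_distrib)
  also have "\<dots> \<le> K * L2_set (\<lambda>j. (real j + 1) powr \<gamma> * cmod (fps_nth E j)) {..m}"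
    unfolding L2_set_def using K m by (intro mult_left_mono real_sqrt_le_mono sum_mono2) auto
  also have "\<dots> \<le> K * b"
    using K E by (intro mult_left_mono wl2_boundedD) auto
  finally show "L2_set ?u S \<le> K * b" .
qed

text \<open>The coefficients off the diagonal are dropped, which only lowers the norm; those on it
  are compared weight by weight.\<close>

lemma wl2_bounded_diag:
  assumes M: "M \<ge> 1" and a: "dbounded \<alpha> a b" and K: "K \<ge> 0"
    and wt: "\<And>j. (real j + 1) powr \<gamma> \<le> K * wt \<alpha> (M * j) (N * j)"
    and E: "\<And>j. fps_nth E j = a (M * j) (N * j)"
  shows "wl2_bounded \<gamma> E (K * b)"
  unfolding wl2_bounded_def
proof
  fix m
  let ?h = "\<lambda>j. (M * j, N * j)"
  let ?u = "\<lambda>(k, l). wt \<alpha> k l * cmod (a k l)"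
  have "L2_set (\<lambda>j. (real j + 1) powr \<gamma> * cmod (fps_nth E j)) {..m} \<le> L2_set (\<lambda>j. K * ?u (?h j)) {..m}"
  proof (rule L2_set_mono)
    fix j
    show "(real j + 1) powr \<gamma> * cmod (fps_nth E j) \<le> K * ?u (?h j)"
      using mult_right_mono[OF wt norm_ge_zero] by (simp add: mult.assoc E)
  qed auto
  also have "\<dots> = K * L2_set (\<lambda>j. ?u (?h j)) {..m}"
    using K by (simp add: L2_set_right_distrib)
  also have "L2_set (\<lambda>j. ?u (?h j)) {..m} = L2_set ?u (?h ` {..m})"
  proof -
    have "inj_on ?h {..m}" using inj_diag[OF M] by (rule inj_on_subset) simp
    then show ?thesis unfolding L2_set_def by (subst sum.reindex) auto
  qed
  also have "K * L2_set ?u (?h ` {..m}) \<le> K * b"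
    using a K unfolding dbounded_def by (intro mult_left_mono) auto
  finally show "L2_set (\<lambda>j. (real j + 1) powr \<gamma> * cmod (fps_nth E j)) {..m} \<le> K * b" .
qed

section \<open>Two-sided estimates for the distance\<close>

lemma dist_one_le:
  assumes "p \<in> poly_space n"
  shows "dist_one \<alpha> f n \<le> dirichlet_norm \<alpha> (\<lambda>z. p z * f z - 1)"
  unfolding dist_one_def using assms by (intro cINF_lower bdd_belowI2[of _ 0]) auto

lemma dist_one_ge:
  assumes "\<And>p. p \<in> poly_space n \<Longrightarrow> c \<le> dirichlet_norm \<alpha> (\<lambda>z. p z * f z - 1)"
  shows "c \<le> dist_one \<alpha> f n"
  unfolding dist_one_def using assms poly_space_0 by (intro cINF_greatest) auto

lemma eval_fps_finite_support:
  fixes P :: "complex fps"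
  assumes "\<And>k. k > n \<Longrightarrow> fps_nth P k = 0"
  shows "eval_fps P z = (\<Sum>k\<le>n. fps_nth P k * z ^ k)"
  unfolding eval_fps_def by (rule suminf_finite) (use assms in auto)

text \<open>The conclusion supplies the polynomial itself, since it serves both the distance
  estimate and cyclicity.\<close>

lemma diag_upper_bound:
  assumes M: "M \<ge> 1" and \<beta>: "diag_exp \<alpha> N \<le> 1" and F: "fps_conv_radius F > 1"
    and f: "\<And>z1 z2. (z1, z2) \<in> bidisk \<Longrightarrow> f (z1, z2) = eval_fps F (z1 ^ M * z2 ^ N)"
    and nz: "\<And>z. cmod z < 1 \<Longrightarrow> eval_fps F z \<noteq> 0"
  obtains C where "\<And>n. n \<ge> 1 \<Longrightarrow> \<exists>p\<in>poly_space n.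
    (dirichlet_norm \<alpha> (\<lambda>z. p z * f z - 1))\<^sup>2 \<le> C / phi (diag_exp \<alpha> N) (real n + 1)"
proof -
  define \<beta> where "\<beta> = diag_exp \<alpha> N"
  note \<beta> = \<beta>[folded \<beta>_def]
  have "approx_invertible \<beta> F"
    using \<beta> F nz by (rule approx_invertible_zero_free)
  then obtain C d where Cd: "\<And>n. \<exists>P. (\<forall>k>d * n. fps_nth P k = 0) \<and>
     l1_bounded (1 - P * F) C \<and> wl2_bounded (\<beta>/2) (1 - P * F) (C / sqrt (psum \<beta> n))"
    unfolding approx_invertible_def by blast
  obtain K where K: "K \<ge> 1" "\<And>j. wt \<alpha> (M * j) (N * j) \<le> K * (real j + 1) powr (\<beta> / 2)"
    unfolding \<beta>_def by (rule wt_diag[OF M, of \<alpha> N]) blast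
  obtain A where A: "A > 0" "\<And>n. phi \<beta> (real n + 1) \<le> A * psum \<beta> n"
    using phi_le_psum[OF \<beta>] by blast
  \<comment> \<open>With m = n div e, a polynomial P of degree d m becomes one of degree at most (M
    + N) d m \<le> n in each variable. \<open>Suc d\<close> keeps e positive when d = 0.\<close>
  define e where "e = (M + N) * Suc d"
  have e: "e \<ge> 1" using M by (simp add: e_def)
  define D where "D = real e powr (1 + \<bar>\<beta>\<bar>)"
  have D: "D > 0" using e by (simp add: D_def)
  have "\<exists>p\<in>poly_space n. (dirichlet_norm \<alpha> (\<lambda>z. p z * f z - 1))\<^sup>2 \<le> (K * C)\<^sup>2 * D * A / phi \<beta> (real n + 1)"
    if n: "n \<ge> 1" for n
  proof -
    define m where "m = n div e"
    obtain P where P: "\<And>k. k > d * m \<Longrightarrow> fps_nth P k = 0"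
      "wl2_bounded (\<beta>/2) (1 - P * F) (C / sqrt (psum \<beta> m))"
      using Cd[of m] by auto
    define p where "p z = (\<Sum>k\<le>d * m. fps_nth P k * fst z ^ (M * k) * snd z ^ (N * k))" for z :: "complex \<times> complex"
    have le: "(M + N) * k \<le> n" if "k \<le> d * m" for k
    proof -
      have "(M + N) * k \<le> (M + N) * (Suc d * m)"
        using that by (intro mult_left_mono) auto
      also have "\<dots> = e * m" by (simp only: e_def mult.assoc)
      also have "\<dots> \<le> n" by (simp add: m_def)
      finally show ?thesis .
    qed
    have p: "p \<in> poly_space n"
      unfolding p_def[abs_def]
    proof (intro poly_space_sum poly_space_monomial)
      fix k assume "k \<in> {..d * m}"
      then have "M * k + N * k \<le> n" using le[of k] by (simp add: distrib_right)
      then show "M * k \<le> n" "N * k \<le> n" by linarith+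
    qed
    have radP: "fps_conv_radius P = \<infinity>"
      using P(1) by (rule fps_conv_radius_finite_support)
    have radPF: "fps_conv_radius (P * F) > 1"
      using F radP by (intro fps_conv_radius_mult_gt_1) auto
    have rad: "fps_conv_radius (P * F - 1) > 1"
      using radPF by (intro less_le_trans[OF _ fps_conv_radius_diff]) auto
    have exp: "has_bidisk_expansion (\<lambda>z. p z * f z - 1) (diag_coeff M N (fps_nth (P * F - 1)))"
    proof (rule has_bidisk_expansion_diag[OF M less_imp_le[OF rad]])
      fix z1 z2 assume z: "(z1, z2) \<in> bidisk"
      let ?w = "z1 ^ M * z2 ^ N"
      have w: "ereal (cmod ?w) < r" if "r > 1" for r
        using monomial_in_disk[OF z M, of N] that by (intro ereal_less_of_le_1) auto
      have "eval_fps (P * F - 1) ?w = eval_fps (P * F) ?w - eval_fps 1 ?w"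
        by (rule eval_fps_diff) (auto intro: w radPF)
      also have "eval_fps (P * F) ?w = eval_fps P ?w * eval_fps F ?w"
        by (rule eval_fps_mult) (auto intro: w F simp: radP)
      also have "eval_fps P ?w = p (z1, z2)"
        by (subst eval_fps_finite_support[OF P(1)]) (auto simp: p_def power_mult power_mult_distrib mult.assoc)
      finally show "p (z1, z2) * f (z1, z2) - 1 = eval_fps (P * F - 1) ?w"
        by (simp add: f[OF z])
    qed
    have "wl2_bounded (\<beta>/2) (P * F - 1) (C / sqrt (psum \<beta> m))"
      using P(2) wl2_bounded_uminus[of "\<beta>/2" "1 - P * F"] by simp
    then have "dbounded \<alpha> (diag_coeff M N (fps_nth (P * F - 1))) (K * (C / sqrt (psum \<beta> m)))"
      using K by (intro dbounded_diag M) auto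
    then have "dirichlet_norm \<alpha> (\<lambda>z. p z * f z - 1) \<le> K * (C / sqrt (psum \<beta> m))"
      using exp by (intro dirichlet_norm_le)
    then have "(dirichlet_norm \<alpha> (\<lambda>z. p z * f z - 1))\<^sup>2 \<le> (K * (C / sqrt (psum \<beta> m)))\<^sup>2"
      by (intro power_mono) auto
    also have "\<dots> = (K * C)\<^sup>2 / psum \<beta> m"
      by (simp add: power_divide power_mult_distrib less_imp_le)
    also have "\<dots> \<le> (K * C)\<^sup>2 * (D * A / phi \<beta> (real n + 1))"
    proof -
      have "phi \<beta> (real n + 1) \<le> A * (D * psum \<beta> m)"
        using A(2)[of n] psum_div_le[OF e, of \<beta> n] A(1) unfolding m_def D_def
        by (meson mult_left_mono order_trans less_imp_le)
      then have "1 / psum \<beta> m \<le> D * A / phi \<beta> (real n + 1)"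
        using phi_pos[OF n, of \<beta>] by (simp add: field_simps)
      then show ?thesis
        using mult_left_mono[of "1 / psum \<beta> m" "D * A / phi \<beta> (real n + 1)" "(K * C)\<^sup>2"] by simp
    qed
    finally show ?thesis using p by (auto simp: mult.assoc)
  qed
  then show ?thesis using that unfolding \<beta>_def by blast
qed

text \<open>Multiplication by z1^i z2^j translates the diagonal by (i, j), and the translate meets
  the diagonal only if (i, j) lies on it. So the diagonal part of p f is the diagonal part of p
  times F.\<close>

lemma diag_coeff_shift_sum:
  fixes c :: "nat \<Rightarrow> nat \<Rightarrow> complex" and F :: "complex fps"
  assumes M: "M \<ge> 1"
  shows "(\<Sum>i\<le>n. \<Sum>j\<le>n. c i j * shift_coeff i j (diag_coeff M N (fps_nth F)) (M * k) (N * k)) =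
    fps_nth (Abs_fps (\<lambda>m. if M * m \<le> n \<and> N * m \<le> n then c (M * m) (N * m) else 0) * F) k"
proof -
  let ?g = "\<lambda>(i, j). c i j * shift_coeff i j (diag_coeff M N (fps_nth F)) (M * k) (N * k)"
  let ?h = "\<lambda>m. (M * m, N * m)"
  define T where "T = {m. m \<le> k \<and> M * m \<le> n \<and> N * m \<le> n}"
  have zero: "?g (i, j) = 0" if ij: "(i, j) \<in> {..n} \<times> {..n} - ?h ` T" for i j
  proof (rule ccontr)
    assume "?g (i, j) \<noteq> 0"
    then have le: "i \<le> M * k" "j \<le> N * k" and "diag_coeff M N (fps_nth F) (M * k - i) (N * k - j) \<noteq> 0"
      by (auto simp: shift_coeff_def split: if_splits)
    then have "(M * k - i, N * k - j) \<in> range ?h"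
      using diag_coeff_off by blast
    then obtain m where m: "M * k - i = M * m" "N * k - j = N * m" by auto
    have "M * m \<le> M * k" using m(1) by linarith
    then have mk: "m \<le> k" using M by simp
    have "i = M * (k - m)" "j = N * (k - m)"
      using m le by (simp_all add: diff_mult_distrib2)
    then have "(i, j) \<in> ?h ` T"
      using ij by (auto simp: T_def)
    then show False using ij by blast
  qed
  have "(\<Sum>i\<le>n. \<Sum>j\<le>n. c i j * shift_coeff i j (diag_coeff M N (fps_nth F)) (M * k) (N * k)) = sum ?g ({..n} \<times> {..n})"
    by (simp add: sum.cartesian_product)
  also have "\<dots> = sum ?g (?h ` T)"
    using zero by (intro sum.mono_neutral_right) (auto simp: T_def)
  also have "\<dots> = (\<Sum>m\<in>T. ?g (?h m))"
    using inj_diag[OF M] by (subst sum.reindex) (auto intro: inj_on_subset)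
  also have "\<dots> = (\<Sum>m\<in>T. c (M * m) (N * m) * fps_nth F (k - m))"
  proof (intro sum.cong refl)
    fix m assume "m \<in> T"
    then have "m \<le> k" by (simp add: T_def)
    then show "?g (?h m) = c (M * m) (N * m) * fps_nth F (k - m)"
      using M diag_coeff_diag[of M N "fps_nth F" "k - m"] by (simp add: shift_coeff_def diff_mult_distrib2)
  qed
  also have "\<dots> = (\<Sum>m=0..k. (if M * m \<le> n \<and> N * m \<le> n then c (M * m) (N * m) else 0) * fps_nth F (k - m))"
    by (rule sum.mono_neutral_cong_left) (auto simp: T_def)
  finally show ?thesis by (simp add: fps_mult_nth)
qed

lemma diag_lower_bound:
  assumes M: "M \<ge> 1" and \<beta>: "diag_exp \<alpha> N \<le> 1" and F: "fps_conv_radius F > 1"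
    and f: "\<And>z1 z2. (z1, z2) \<in> bidisk \<Longrightarrow> f (z1, z2) = eval_fps F (z1 ^ M * z2 ^ N)"
    and f_space: "f \<in> dirichlet_space \<alpha>"
    and nz: "\<And>z. cmod z < 1 \<Longrightarrow> eval_fps F z \<noteq> 0"
    and \<zeta>: "cmod \<zeta> = 1" "eval_fps F \<zeta> = 0"
  shows "\<exists>c>0. \<forall>\<^sub>F n in sequentially. c / phi (diag_exp \<alpha> N) (real n + 1) \<le> (dist_one \<alpha> f n)\<^sup>2"
proof -
  define \<beta> where "\<beta> = diag_exp \<alpha> N"
  note \<beta> = \<beta>[folded \<beta>_def]
  obtain K where K: "K \<ge> 1" "\<And>j. (real j + 1) powr (\<beta> / 2) \<le> K * wt \<alpha> (M * j) (N * j)"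
    unfolding \<beta>_def by (rule wt_diag[OF M, of \<alpha> N]) blast
  have f_exp: "has_bidisk_expansion f (diag_coeff M N (fps_nth F))"
    using F f by (intro has_bidisk_expansion_diag[OF M]) auto
  obtain A where A: "A > 0" "\<And>n. n \<ge> 1 \<Longrightarrow> psum \<beta> n \<le> A * phi \<beta> (real n + 1)"
    using psum_le_phi[OF \<beta>] by blast
  define B where "B = 2 powr (1 + \<bar>\<beta>\<bar>)"
  have B: "B > 0" by (simp add: B_def)
  \<comment> \<open>From the square of 1/(2 K s), where s^2 = psum \<beta> (2 n) is at most B A
    times \<open>phi\<close>; B is the cost of passing from 2n to n.\<close>
  define c where "c = 1 / (4 * K\<^sup>2 * (B * A))"
  have c: "c > 0" using K A B by (simp add: c_def)
  have "eventually (\<lambda>n. \<forall>P D. (\<forall>k>n. fps_nth P k = 0) \<longrightarrow> D \<le> K \<longrightarrow>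
    wl2_bounded (\<beta>/2) (1 - P * F) D \<longrightarrow> 1/2 \<le> D * sqrt (psum \<beta> (2 * n))) sequentially"
    using F nz \<zeta> by (rule wl2_lower_bound)
  then have "\<forall>\<^sub>F n in sequentially. c / phi \<beta> (real n + 1) \<le> (dist_one \<alpha> f n)\<^sup>2"
    using eventually_ge_at_top[of 1]
  proof eventually_elim
    case (elim n)
    define s where "s = sqrt (psum \<beta> (2 * n))"
    have s: "s \<ge> 1" using psum_ge_1[of \<beta> "2 * n"] by (simp add: s_def)
    have "1 / (2 * K * s) \<le> dirichlet_norm \<alpha> (\<lambda>z. p z * f z - 1)" if p: "p \<in> poly_space n" for p
    proof -
      define D where "D = dirichlet_norm \<alpha> (\<lambda>z. p z * f z - 1)"
      obtain c where c: "p = (\<lambda>z. \<Sum>i\<le>n. \<Sum>j\<le>n. c i j * fst z ^ i * snd z ^ j)"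
        using poly_spaceE[OF p] .
      define P where "P = Abs_fps (\<lambda>m. if M * m \<le> n \<and> N * m \<le> n then c (M * m) (N * m) else 0)"
      define a where "a k l = (\<Sum>i\<le>n. \<Sum>j\<le>n. c i j * shift_coeff i j (diag_coeff M N (fps_nth F)) k l) +
        (-1) * (if k = 0 \<and> l = 0 then 1 else 0)" for k l :: nat
      have "has_bidisk_expansion (\<lambda>z. (\<Sum>i\<le>n. \<Sum>j\<le>n. c i j * (fst z ^ i * snd z ^ j * f z)) + (-1) * 1) a"
        unfolding a_def[abs_def]
        by (intro has_bidisk_expansion_add has_bidisk_expansion_sum has_bidisk_expansion_cmult
            has_bidisk_expansion_shift f_exp has_bidisk_expansion_1)
      also have "(\<lambda>z. (\<Sum>i\<le>n. \<Sum>j\<le>n. c i j * (fst z ^ i * snd z ^ j * f z)) + (-1) * 1) = (\<lambda>z. p z * f z - 1)"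
        unfolding c sum_distrib_right by (simp add: mult.assoc)
      finally have exp: "has_bidisk_expansion (\<lambda>z. p z * f z - 1) a" .
      have "(\<lambda>z. p z * f z) \<in> dirichlet_space \<alpha>"
        using poly_multiplier[OF p, of \<alpha>] f_space by metis
      then have "(\<lambda>z. p z * f z - 1) \<in> dirichlet_space \<alpha>"
        using dirichlet_diff[OF _ dirichlet_1] by simp
      then have "dbounded \<alpha> a D"
        unfolding D_def using exp by (rule dirichlet_space_dbounded)
      then have "wl2_bounded (\<beta>/2) (P * F - 1) (K * D)"
      proof (rule wl2_bounded_diag[OF M])
        fix k
        show "fps_nth (P * F - 1) k = a (M * k) (N * k)"
          unfolding a_def diag_coeff_shift_sum[OF M] using M by (auto simp: P_def)
      qed (use K in auto)
      then have wl2: "wl2_bounded (\<beta>/2) (1 - P * F) (K * D)"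
        using wl2_bounded_uminus[of "\<beta>/2" "1 - P * F"] by simp
      have P0: "\<forall>k>n. fps_nth P k = 0"
      proof (intro allI impI)
        fix k assume "k > n"
        then have "n < M * k" using M by (metis less_le_trans mult_le_mono1 mult_1)
        then show "fps_nth P k = 0" by (simp add: P_def)
      qed
      \<comment> \<open>\<open>wl2_lower_bound\<close> is uniform only over errors of bounded norm.
        It is used with the bound K, which covers D \<le> 1; for D > 1 the inequality is immediate,
        as K and s are at least 1.\<close>
      have "1/2 \<le> K * D * s"
      proof (cases "D \<le> 1")
        case True
        then have "K * D \<le> K" using K(1) by (simp add: mult_le_cancel_left1)
        then show ?thesis using elim(1) P0 wl2 unfolding s_def by blast
      next
        case False
        then have "1 * 1 * 1 \<le> K * D * s"
          using K(1) s by (intro mult_mono) auto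
        then show ?thesis by simp
      qed
      then show ?thesis
        using K(1) s unfolding D_def[symmetric] by (simp add: field_simps)
    qed
    then have "1 / (2 * K * s) \<le> dist_one \<alpha> f n"
      by (rule dist_one_ge)
    then have "(1 / (2 * K * s))\<^sup>2 \<le> (dist_one \<alpha> f n)\<^sup>2"
      using K(1) s by (intro power_mono) auto
    moreover have "c / phi \<beta> (real n + 1) \<le> (1 / (2 * K * s))\<^sup>2"
    proof -
      have "psum \<beta> (2 * n) \<le> B * (A * phi \<beta> (real n + 1))"
      proof (rule order_trans)
        show "psum \<beta> (2 * n) \<le> B * psum \<beta> n"
          using psum_div_le[of 2 \<beta> "2 * n"] by (simp add: B_def)
        show "B * psum \<beta> n \<le> B * (A * phi \<beta> (real n + 1))"
          using A(2)[OF elim(2)] B by (intro mult_left_mono) auto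
      qed
      then have "1 / (4 * K\<^sup>2 * (B * (A * phi \<beta> (real n + 1)))) \<le> 1 / (4 * K\<^sup>2 * psum \<beta> (2 * n))"
        using K(1) A(1) B phi_pos[OF elim(2), of \<beta>]
        by (intro divide_left_mono mult_left_mono mult_pos_pos) auto
      also have "\<dots> = (1 / (2 * K * s))\<^sup>2"
        by (simp add: s_def power_divide power_mult_distrib less_imp_le)
      finally show ?thesis by (simp add: c_def mult.assoc)
    qed
    ultimately show ?case by linarith
  qed
  then show ?thesis using c unfolding \<beta>_def by blast
qed

lemma diag_main:
  assumes M: "M \<ge> 1" and \<beta>: "diag_exp \<alpha> N \<le> 1" and G: "G analytic_on cball 0 1"
    and nz: "\<forall>z\<in>ball 0 1. G z \<noteq> 0" and f_space: "f \<in> dirichlet_space \<alpha>"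
    and f: "\<And>z1 z2. (z1, z2) \<in> bidisk \<Longrightarrow> f (z1, z2) = G (z1 ^ M * z2 ^ N)"
  shows "cyclic \<alpha> f \<and>
    (\<exists>C. \<forall>n\<ge>1. (dist_one \<alpha> f n)\<^sup>2 \<le> C / phi (diag_exp \<alpha> N) (real n + 1)) \<and>
    ((\<exists>\<zeta>\<in>sphere 0 1. G \<zeta> = 0) \<longrightarrow>
      (\<exists>c>0. \<forall>\<^sub>F n in sequentially. c / phi (diag_exp \<alpha> N) (real n + 1) \<le> (dist_one \<alpha> f n)\<^sup>2))"
proof -
  obtain F where F: "fps_conv_radius F > 1" "\<And>z. cmod z \<le> 1 \<Longrightarrow> eval_fps F z = G z"
    using analytic_on_cball_imp_fps[OF G] by blast
  have fF: "f (z1, z2) = eval_fps F (z1 ^ M * z2 ^ N)" if "(z1, z2) \<in> bidisk" for z1 z2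
    using f[OF that] monomial_in_disk[OF that M, of N] F(2) by simp
  have nzF: "eval_fps F z \<noteq> 0" if "cmod z < 1" for z
    using nz F(2)[of z] that by auto
  obtain C where C: "\<And>n. n \<ge> 1 \<Longrightarrow> \<exists>p\<in>poly_space n.
      (dirichlet_norm \<alpha> (\<lambda>z. p z * f z - 1))\<^sup>2 \<le> C / phi (diag_exp \<alpha> N) (real n + 1)"
    using diag_upper_bound[OF M \<beta> F(1) fF nzF] by blast
  have "(dist_one \<alpha> f n)\<^sup>2 \<le> C / phi (diag_exp \<alpha> N) (real n + 1)" if n: "n \<ge> 1" for n
  proof -
    obtain p where p: "p \<in> poly_space n"
        "(dirichlet_norm \<alpha> (\<lambda>z. p z * f z - 1))\<^sup>2 \<le> C / phi (diag_exp \<alpha> N) (real n + 1)"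
      using C[OF n] by blast
    have "0 \<le> dist_one \<alpha> f n"
      by (rule dist_one_ge) simp
    then have "(dist_one \<alpha> f n)\<^sup>2 \<le> (dirichlet_norm \<alpha> (\<lambda>z. p z * f z - 1))\<^sup>2"
      using dist_one_le[OF p(1)] by (intro power_mono) auto
    then show ?thesis using p(2) by linarith
  qed
  moreover have "cyclic \<alpha> f"
  proof (rule cyclicI[OF f_space])
    fix \<epsilon> :: real assume \<epsilon>: "\<epsilon> > 0"
    have "((\<lambda>n. C / phi (diag_exp \<alpha> N) (real n + 1)) \<longlongrightarrow> 0) sequentially"
      by (intro tendsto_divide_0[OF tendsto_const] filterlim_at_top_imp_at_infinity filterlim_phi \<beta>)
    then have "eventually (\<lambda>n. C / phi (diag_exp \<alpha> N) (real n + 1) < \<epsilon>\<^sup>2) sequentially"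
      by (rule order_tendstoD) (use \<epsilon> in simp)
    then have "eventually (\<lambda>n. C / phi (diag_exp \<alpha> N) (real n + 1) < \<epsilon>\<^sup>2 \<and> n \<ge> 1) sequentially"
      using eventually_ge_at_top[of 1] by eventually_elim simp
    then obtain n where n: "C / phi (diag_exp \<alpha> N) (real n + 1) < \<epsilon>\<^sup>2" "n \<ge> 1"
      by (auto simp: eventually_sequentially)
    then obtain p where p: "p \<in> poly_space n" "(dirichlet_norm \<alpha> (\<lambda>z. p z * f z - 1))\<^sup>2 < \<epsilon>\<^sup>2"
      using C[OF n(2)] by (meson le_less_trans)
    have "dirichlet_norm \<alpha> (\<lambda>z. p z * f z - 1) < \<epsilon>"
      using p(2) \<epsilon> by (simp add: power2_less_imp_less)
    then show "\<exists>n. \<exists>p\<in>poly_space n. dirichlet_norm \<alpha> (\<lambda>z. p z * f z - 1) < \<epsilon>"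
      using p(1) by blast
  qed
  moreover have "\<exists>c>0. \<forall>\<^sub>F n in sequentially. c / phi (diag_exp \<alpha> N) (real n + 1) \<le> (dist_one \<alpha> f n)\<^sup>2"
    if "\<zeta> \<in> sphere 0 1" "G \<zeta> = 0" for \<zeta>
    using that F(2)[of \<zeta>] by (intro diag_lower_bound[OF M \<beta> F(1) fF f_space nzF, of \<zeta>]) auto
  ultimately show ?thesis by blast
qed

text \<open>Membership in \<open>J_space\<close> gives an ordered series, whereas the coefficients
  are defined by unordered summation. A radius of convergence of at least 1 makes the series
  absolutely convergent, and uniqueness of the expansion then identifies the coefficients.\<close>

lemma J_space_series:
  assumes f: "f \<in> J_space \<alpha> M N" and M: "M \<ge> 1" and z: "(z1, z2) \<in> bidisk"
  shows "f (z1, z2) = R_op M N f (z1 ^ M * z2 ^ N)"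
proof -
  obtain a where a: "\<And>z1 z2. (z1, z2) \<in> bidisk \<Longrightarrow> (\<lambda>k. a k * z1 ^ (M * k) * z2 ^ (N * k)) sums f (z1, z2)"
    using f unfolding J_space_def by auto
  define F where "F = Abs_fps a"
  have eq: "a k * z1 ^ (M * k) * z2 ^ (N * k) = fps_nth F k * (z1 ^ M * z2 ^ N) ^ k" for z1 z2 k
    by (simp add: F_def power_mult power_mult_distrib)
  have "fps_conv_radius F \<ge> 1"
    unfolding fps_conv_radius_def
  proof (rule conv_radius_geI_ex)
    fix r :: real assume r: "0 < r" "ereal r < 1"
    then have r1: "r < 1" by (simp add: one_ereal_def)
    \<comment> \<open>At the point (x, x) of the bidisk the monomial z1^M z2^N takes the value r, so
      the one-variable series converges at every r in (0, 1).\<close>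
    define x where "x = root (M + N) r"
    have x: "0 < x" "x < 1" "x ^ (M + N) = r"
      using r(1) r1 M by (auto simp: x_def)
    have "(of_real x, of_real x) \<in> bidisk"
      using x by (simp add: bidisk_def)
    from sums_summable[OF a[OF this]] have "summable (\<lambda>k. fps_nth F k * of_real r ^ k)"
      unfolding eq power_add[symmetric] by (simp only: x(3) flip: of_real_power)
    then show "\<exists>z. cmod z = r \<and> summable (\<lambda>k. fps_nth F k * z ^ k)"
      using r by (intro exI[of _ "of_real r"]) auto
  qed
  moreover have fF: "f (z1, z2) = eval_fps F (z1 ^ M * z2 ^ N)" if "(z1, z2) \<in> bidisk" for z1 z2
    using sums_unique[OF a[OF that]] by (simp add: eval_fps_def eq)
  ultimately have "bidisk_coeff f = diag_coeff M N (fps_nth F)"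
    using M by (intro bidisk_coeff_eq has_bidisk_expansion_diag)
  then show ?thesis
    using M fF[OF z] by (simp add: R_op_def eval_fps_def)
qed

theorem theorem3p1:
  shows
  "(\<forall>(\<alpha>::real) (M::nat) (N::nat) (f :: complex \<times> complex \<Rightarrow> complex) (G :: complex \<Rightarrow> complex).
      \<alpha> \<le> 1/2 \<longrightarrow> M \<ge> 1 \<longrightarrow> N \<ge> 1 \<longrightarrow> f \<in> J_space \<alpha> M N \<longrightarrow>
      continues_to_closed_disk (R_op M N f) G \<longrightarrow> (\<forall>z\<in>ball 0 1. G z \<noteq> 0) \<longrightarrow>
        cyclic \<alpha> f \<and>
        (\<exists>C. \<forall>n\<ge>1. (dist_one \<alpha> f n)\<^sup>2 \<le> C / phi (2 * \<alpha>) (real n + 1)) \<and>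
        ((\<exists>\<zeta>\<in>sphere 0 1. G \<zeta> = 0) \<longrightarrow>
          (\<exists>c>0. \<forall>\<^sub>F n in sequentially. c / phi (2 * \<alpha>) (real n + 1) \<le> (dist_one \<alpha> f n)\<^sup>2)))
   \<and>
   (\<forall>(\<alpha>::real) (f :: complex \<times> complex \<Rightarrow> complex) (F :: complex \<Rightarrow> complex) (G :: complex \<Rightarrow> complex).
      \<alpha> \<le> 1 \<longrightarrow> f \<in> I_space \<alpha> \<longrightarrow> (\<forall>(z1, z2)\<in>bidisk. f (z1, z2) = F z1) \<longrightarrow>
      continues_to_closed_disk F G \<longrightarrow> (\<forall>z\<in>ball 0 1. G z \<noteq> 0) \<longrightarrow>
        cyclic \<alpha> f \<and>
        (\<exists>C. \<forall>n\<ge>1. (dist_one \<alpha> f n)\<^sup>2 \<le> C / phi \<alpha> (real n + 1)) \<and>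
        ((\<exists>\<zeta>\<in>sphere 0 1. G \<zeta> = 0) \<longrightarrow>
          (\<exists>c>0. \<forall>\<^sub>F n in sequentially. c / phi \<alpha> (real n + 1) \<le> (dist_one \<alpha> f n)\<^sup>2)))"
proof (rule conjI; intro allI impI)
  fix \<alpha> :: real and M N :: nat and f :: "complex \<times> complex \<Rightarrow> complex" and G :: "complex \<Rightarrow> complex"
  assume \<alpha>: "\<alpha> \<le> 1/2" and M: "M \<ge> 1" and N: "N \<ge> 1" and f: "f \<in> J_space \<alpha> M N"
    and G: "continues_to_closed_disk (R_op M N f) G" and nz: "\<forall>z\<in>ball 0 1. G z \<noteq> 0"
  have "f (z1, z2) = G (z1 ^ M * z2 ^ N)" if z: "(z1, z2) \<in> bidisk" for z1 z2
    using J_space_series[OF f M z] G monomial_in_disk[OF z M, of N]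
    by (simp add: continues_to_closed_disk_def)
  then show "cyclic \<alpha> f \<and>
        (\<exists>C. \<forall>n\<ge>1. (dist_one \<alpha> f n)\<^sup>2 \<le> C / phi (2 * \<alpha>) (real n + 1)) \<and>
        ((\<exists>\<zeta>\<in>sphere 0 1. G \<zeta> = 0) \<longrightarrow>
          (\<exists>c>0. \<forall>\<^sub>F n in sequentially. c / phi (2 * \<alpha>) (real n + 1) \<le> (dist_one \<alpha> f n)\<^sup>2))"
    using diag_main[of M \<alpha> N G f] \<alpha> M N f G nz
    by (simp add: diag_exp_def J_space_def continues_to_closed_disk_def)
next
  fix \<alpha> :: real and f :: "complex \<times> complex \<Rightarrow> complex" and F G :: "complex \<Rightarrow> complex"
  assume \<alpha>: "\<alpha> \<le> 1" and f: "f \<in> I_space \<alpha>" and F: "\<forall>(z1, z2)\<in>bidisk. f (z1, z2) = F z1"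
    and G: "continues_to_closed_disk F G" and nz: "\<forall>z\<in>ball 0 1. G z \<noteq> 0"
  have "f (z1, z2) = G (z1 ^ 1 * z2 ^ 0)" if "(z1, z2) \<in> bidisk" for z1 z2
    using that F G by (auto simp: continues_to_closed_disk_def bidisk_def)
  then show "cyclic \<alpha> f \<and>
        (\<exists>C. \<forall>n\<ge>1. (dist_one \<alpha> f n)\<^sup>2 \<le> C / phi \<alpha> (real n + 1)) \<and>
        ((\<exists>\<zeta>\<in>sphere 0 1. G \<zeta> = 0) \<longrightarrow>
          (\<exists>c>0. \<forall>\<^sub>F n in sequentially. c / phi \<alpha> (real n + 1) \<le> (dist_one \<alpha> f n)\<^sup>2))"
    using diag_main[of 1 \<alpha> 0 G f] \<alpha> f G nz
    by (simp add: diag_exp_def I_space_def continues_to_closed_disk_def)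
qed

end
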